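(* Let $I\times J=[a,b]\times[c,d]\subset\mathbb{R}^2$, let $M,N\in\mathbb{N}\cup\{0\}$ and let $P:I\times J\to\mathbb{R}$ be an integrable function. Then the inequality $$\Lambda(f)=\int_a^b\int_c^d P(y,z)f(y,z)\,dz\,dy\ge 0$$ holds for all $(M+1,N+1)$-$\nabla$-convex functions $f:I\times J\to\mathbb{R}$ having continuous partial derivatives $f_{(i,j)}$ for $i\in\{0,\ldots,M+1\}$, $j\in\{0,\ldots,N+1\}$, if and only if $$\int_a^b\int_c^d P(y,z)\frac{(b-y)^i}{i!}\frac{(d-z)^j}{j!}\,dz\,dy=0,\quad i\in\{0,\ldots,M\},\ j\in\{0,\ldots,N\};$$ $$\int_a^s\int_c^d P(y,z)\frac{(s-y)^M}{M!}\frac{(d-z)^j}{j!}\,dz\,dy=0,\quad j\in\{0,\ldots,N\},\ \forall s\in[a,b];$$ $$\int_a^b\int_c^t P(y,z)\frac{(b-y)^i}{i!}\frac{(t-z)^N}{N!}\,dz\,dy=0,\quad i\in\{0,\ldots,M\},\ \forall t\in[c,d];$$ $$\int_a^s\int_c^t P(y,z)\frac{(s-y)^M}{M!}\frac{(t-z)^N}{N!}\,dz\,dy\ge 0,\quad \forall s\in[a,b],\ \forall t\in[c,d].$$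
   Context: $f_{(i,j)}=\dfrac{\partial^{i+j}f}{\partial y^i\partial z^j}$, with $f_{(0,0)}=f$; $(\cdot)^0=1$. One-variable divided differences at distinct points: $[x_j;g]=g(x_j)$, $[x_i,\ldots,x_{i+l};g]=\dfrac{[x_{i+1},\ldots,x_{i+l};g]-[x_i,\ldots,x_{i+l-1};g]}{x_{i+l}-x_i}$. A function $f:I\times J\to\mathbb{R}$ is $(m,n)$-$\nabla$-convex if $(-1)^{m+n}[y_i,\ldots,y_{i+m};[z_j,\ldots,z_{j+n};f]]\ge 0$ for all distinct points $y_i,\ldots,y_{i+m}\in I$ and distinct points $z_j,\ldots,z_{j+n}\in J$ (divided difference in $z$, then in $y$). For $f$ with continuous partial derivative $f_{(m,n)}$ (and lower ones), this is equivalent to $(-1)^{m+n}f_{(m,n)}\ge 0$ on $I\times J$. *)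

theory Defs
  imports "HOL-Analysis.Analysis"
begin

text \<open>\<open>divdiff x i l g\<close> is the divided difference \<open>[x\<^sub>i, \<dots>, x\<^sub>i\<^sub>+\<^sub>l; g]\<close>. It is meaningful only
  when \<open>x\<close> is injective on \<open>{i..i + l}\<close>.\<close>

primrec divdiff :: "(nat \<Rightarrow> real) \<Rightarrow> nat \<Rightarrow> nat \<Rightarrow> (real \<Rightarrow> real) \<Rightarrow> real" where
  "divdiff x i 0 g = g (x i)"
| "divdiff x i (Suc l) g = (divdiff x (Suc i) l g - divdiff x i l g) / (x (i + Suc l) - x i)"

definition nabla_convex ::
  "nat \<Rightarrow> nat \<Rightarrow> real set \<Rightarrow> real set \<Rightarrow> (real \<times> real \<Rightarrow> real) \<Rightarrow> bool" where
  "nabla_convex m n I J f \<longleftrightarrow>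
    (\<forall>y z. inj_on y {0..m} \<and> y ` {0..m} \<subseteq> I \<and> inj_on z {0..n} \<and> z ` {0..n} \<subseteq> J \<longrightarrow>
      (-1) ^ (m + n) * divdiff y 0 m (\<lambda>u. divdiff z 0 n (\<lambda>v. f (u, v))) \<ge> 0)"

text \<open>Partial derivatives are taken within the rectangle \<open>I \<times> J\<close>, hence are one-sided on its
  boundary. Values at points of \<open>I \<times> J\<close> depend only on the restriction of \<open>f\<close> to \<open>I \<times> J\<close>.\<close>

definition pderiv_y :: "real set \<Rightarrow> (real \<times> real \<Rightarrow> real) \<Rightarrow> real \<times> real \<Rightarrow> real" where
  "pderiv_y I f = (\<lambda>(y, z). vector_derivative (\<lambda>u. f (u, z)) (at y within I))"

definition pderiv_z :: "real set \<Rightarrow> (real \<times> real \<Rightarrow> real) \<Rightarrow> real \<times> real \<Rightarrow> real" where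
  "pderiv_z J f = (\<lambda>(y, z). vector_derivative (\<lambda>v. f (y, v)) (at z within J))"

definition mixed_pderiv ::
  "real set \<Rightarrow> real set \<Rightarrow> nat \<Rightarrow> nat \<Rightarrow> (real \<times> real \<Rightarrow> real) \<Rightarrow> real \<times> real \<Rightarrow> real" where
  "mixed_pderiv I J i j f = (pderiv_y I ^^ i) ((pderiv_z J ^^ j) f)"

text \<open>Since \<^const>\<open>vector_derivative\<close> is total, existence of the derivatives is required
  separately, following the order of differentiation in \<^const>\<open>mixed_pderiv\<close>: first \<open>j\<close> times
  in \<open>z\<close>, then \<open>i\<close> times in \<open>y\<close>.\<close>

definition has_continuous_pderivs ::
  "nat \<Rightarrow> nat \<Rightarrow> real set \<Rightarrow> real set \<Rightarrow> (real \<times> real \<Rightarrow> real) \<Rightarrow> bool" where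
  "has_continuous_pderivs m n I J f \<longleftrightarrow>
    (\<forall>j<n. \<forall>y\<in>I. \<forall>z\<in>J. (\<lambda>v. mixed_pderiv I J 0 j f (y, v)) differentiable (at z within J)) \<and>
    (\<forall>i<m. \<forall>j\<le>n. \<forall>y\<in>I. \<forall>z\<in>J.
      (\<lambda>u. mixed_pderiv I J i j f (u, z)) differentiable (at y within I)) \<and>
    (\<forall>i\<le>m. \<forall>j\<le>n. continuous_on (I \<times> J) (mixed_pderiv I J i j f))"

end

theory Submission imports Defs begin

text \<open>Iterating the one-variable Taylor formula at the right endpoint, with remainder kernel
  \<open>(s - y)\<^sub>+ ^ M / M!\<close>, writes \<open>f\<close> as a superposition of products \<open>p(y) q(z)\<close> whose factors are
  either powers \<open>(b - y) ^ i / i!\<close>, \<open>(d - z) ^ j / j!\<close> or remainder kernels. By Fubini, the three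
  equality conditions remove every term in which a power occurs, and what is left is the integral of
  \<open>(-1) ^ (M + N) f\<^sub>(\<^sub>M\<^sub>+\<^sub>1\<^sub>,\<^sub>N\<^sub>+\<^sub>1\<^sub>)\<close> against the nonnegative left-hand side of the fourth condition. The
  mean value theorem for divided differences turns \<open>\<nabla>\<close>-convexity into the sign of that derivative.
  Conversely, the kernels are not smooth, but the second difference quotients in \<open>s\<close> of
  \<open>(s - y)\<^sub>+ ^ (M + 2) / (M + 2)!\<close> are of class \<open>C ^ (M + 1)\<close>, have the right sign and converge
  boundedly to the kernel, so each condition follows by dominated convergence.\<close>

section \<open>Divided differences\<close>

text \<open>Three obstacles shape the proof. First, \<open>P\<close> is only Lebesgue integrable,
  while the statement speaks of iterated gauge integrals. Everything is therefore moved to a Borel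
  function \<open>Q\<close> that vanishes off the rectangle, where product measurability and Fubini
  are at hand. Second, the partial derivatives of \<open>f\<close> exist in one order only, first in
  \<open>z\<close> and then in \<open>y\<close>, so both the mean value argument and the Taylor
  expansion have to treat \<open>z\<close> first. Third, the test functions need a continuous
  derivative of order \<open>M + 1\<close>. A first difference quotient of (s - y)_+ ^ (M + 1) is
  not enough, since its derivative of that order jumps; one more integration and one more difference
  make it piecewise linear and continuous. Products of one-variable functions suffice as test
  functions because \<nabla>-convexity of a product splits into sign conditions on the factors.
  Derivatives are carried as an explicit sequence \<open>D\<close>, so that formulas can be supplied
  for concrete functions.\<close>

definition deriv_chain :: "real set \<Rightarrow> nat \<Rightarrow> (nat \<Rightarrow> real \<Rightarrow> real) \<Rightarrow> bool" where
  "deriv_chain S n D \<longleftrightarrow> (\<forall>k<n. \<forall>x\<in>S. (D k has_real_derivative D (Suc k) x) (at x within S))"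

lemma deriv_chainD:
  "deriv_chain S n D \<Longrightarrow> k < n \<Longrightarrow> x \<in> S \<Longrightarrow> (D k has_real_derivative D (Suc k) x) (at x within S)"
  by (auto simp: deriv_chain_def)

lemma deriv_chain_subset: "deriv_chain S n D \<Longrightarrow> T \<subseteq> S \<Longrightarrow> deriv_chain T n D"
  unfolding deriv_chain_def by (blast intro: DERIV_subset)

lemma divdiff_cong:
  "(\<And>k. k \<in> {i..i + l} \<Longrightarrow> f (x k) = g (x k)) \<Longrightarrow> divdiff x i l f = divdiff x i l g"
  by (induction l arbitrary: i) auto

lemma divdiff_diff: "divdiff x i l (\<lambda>t. f t - g t) = divdiff x i l f - divdiff x i l g"
  by (induction l arbitrary: i) (auto simp: diff_divide_distrib)

lemma divdiff_add: "divdiff x i l (\<lambda>t. f t + g t) = divdiff x i l f + divdiff x i l g"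
  by (induction l arbitrary: i) (auto simp: diff_divide_distrib add_divide_distrib)

lemma divdiff_cmult: "divdiff x i l (\<lambda>t. c * f t) = c * divdiff x i l f"
  by (induction l arbitrary: i) (auto simp: right_diff_distrib)

lemma divdiff_cmult_right: "divdiff x i l (\<lambda>t. f t * c) = divdiff x i l f * c"
  using divdiff_cmult[of x i l c f] by (simp add: mult.commute)

lemma divdiff_divide: "divdiff x i l (\<lambda>t. f t / c) = divdiff x i l f / c"
  using divdiff_cmult[of x i l "1/c" f] by simp

lemma divdiff_const: "divdiff x i (Suc l) (\<lambda>t. c) = 0"
proof (induction l arbitrary: i)
  case (Suc l)
  show ?case by (simp only: divdiff.simps(2)[of x i "Suc l"] Suc.IH) simp
qed simp

text \<open>Lets the \<open>z\<close>-difference be treated as the outer one, as required when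
  \<open>z\<close>-derivatives are available only before any \<open>y\<close>-derivative has been
  taken.\<close>

lemma divdiff_commute:
  "divdiff y i m (\<lambda>u. divdiff z j n (\<lambda>v. f (u, v))) = divdiff z j n (\<lambda>v. divdiff y i m (\<lambda>u. f (u, v)))"
  by (induction n arbitrary: j) (simp_all add: divdiff_diff divdiff_divide)

text \<open>Contracting the nodes towards \<alpha> multiplies each of the \<open>l\<close> nested
  denominators by \<tau>; the power compensates for this.\<close>

lemma divdiff_affine:
  assumes "\<tau> \<noteq> 0"
  shows "divdiff x i l (\<lambda>t. g (\<alpha> + \<tau> * (t - \<alpha>))) = \<tau> ^ l * divdiff (\<lambda>k. \<alpha> + \<tau> * (x k - \<alpha>)) i l g"
proof (induction l arbitrary: i)
  case (Suc l)
  have "\<alpha> + \<tau> * (x (i + Suc l) - \<alpha>) - (\<alpha> + \<tau> * (x i - \<alpha>)) = \<tau> * (x (i + Suc l) - x i)"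
    by (simp add: algebra_simps)
  then show ?case
    using assms by (simp only: divdiff.simps Suc.IH) (simp flip: right_diff_distrib)
qed simp

text \<open>The Leibniz rule for a linear factor, whose divided differences of order two and more
  vanish, leaving two terms. The coefficient sits at the last node so that, for \<alpha> the node
  preceding the run, it equals the denominator of the next recursion step.\<close>

lemma divdiff_linear_mult:
  assumes "inj_on x {i..i + Suc l}"
  shows "divdiff x i (Suc l) (\<lambda>t. (t - \<alpha>) * h t) = (x (i + Suc l) - \<alpha>) * divdiff x i (Suc l) h + divdiff x i l h"
  using assms
proof (induction l arbitrary: i)
  case 0
  then have "x (Suc i) - x i \<noteq> 0" using inj_on_contraD[OF 0, of "Suc i" i] by simp
  then show ?case by (simp add: field_simps)
next
  case (Suc l)
  define e where "e = x (i + Suc (Suc l)) - x i"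
  have e: "e \<noteq> 0" using inj_on_contraD[OF Suc.prems, of "i + Suc (Suc l)" i] by (simp add: e_def)
  have 1: "divdiff x (Suc i) (Suc l) (\<lambda>t. (t - \<alpha>) * h t)
      = (x (Suc i + Suc l) - \<alpha>) * divdiff x (Suc i) (Suc l) h + divdiff x (Suc i) l h"
    by (rule Suc.IH) (rule inj_on_subset[OF Suc.prems], auto)
  have 2: "divdiff x i (Suc l) (\<lambda>t. (t - \<alpha>) * h t)
      = (x (i + Suc l) - \<alpha>) * divdiff x i (Suc l) h + divdiff x i l h"
    by (rule Suc.IH) (rule inj_on_subset[OF Suc.prems], auto)
  have e': "x (i + Suc l) - x i \<noteq> 0" using inj_on_contraD[OF Suc.prems, of "i + Suc l" i] by simp
  \<comment> \<open>Facts \<open>3\<close> and \<open>4\<close> are the recursion with denominators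
    cleared; they turn the difference of \<open>1\<close> and \<open>2\<close> into a multiple of
    \<open>e\<close>.\<close>
  have 3: "divdiff x (Suc i) l h - divdiff x i l h = (x (i + Suc l) - x i) * divdiff x i (Suc l) h"
    using e' by simp
  have 4: "divdiff x (Suc i) (Suc l) h = divdiff x i (Suc l) h + e * divdiff x i (Suc (Suc l)) h"
    using e by (simp only: divdiff.simps(2)[of x i "Suc l"] e_def[symmetric]) simp
  have "divdiff x i (Suc (Suc l)) (\<lambda>t. (t - \<alpha>) * h t)
     = (divdiff x (Suc i) (Suc l) (\<lambda>t. (t - \<alpha>) * h t) - divdiff x i (Suc l) (\<lambda>t. (t - \<alpha>) * h t)) / e"
    by (simp only: divdiff.simps(2)[of x i "Suc l"] e_def[symmetric])
  also have "\<dots> = (e * ((x (i + Suc (Suc l)) - \<alpha>) * divdiff x i (Suc (Suc l)) h + divdiff x i (Suc l) h)) / e"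
  proof (rule arg_cong[where f="\<lambda>q. q / e"])
    show "divdiff x (Suc i) (Suc l) (\<lambda>t. (t - \<alpha>) * h t) - divdiff x i (Suc l) (\<lambda>t. (t - \<alpha>) * h t)
      = e * ((x (i + Suc (Suc l)) - \<alpha>) * divdiff x i (Suc (Suc l)) h + divdiff x i (Suc l) h)"
      using 3 unfolding 1 2 4 by (simp add: e_def algebra_simps del: divdiff.simps)
  qed
  finally show ?case using e by simp
qed

text \<open>Eliminates the first node. On the other nodes g(t) = g(x_i) + (t - x_i) h(t) with
  \<open>h\<close> the secant slope; the constant drops out, and \<open>divdiff_linear_mult\<close>
  supplies the factor that cancels the outer denominator.\<close>

lemma divdiff_diff_quotient:
  assumes "inj_on x {i..i + Suc l}"
  shows "divdiff x i (Suc l) g = divdiff x (Suc i) l (\<lambda>t. (g t - g (x i)) / (t - x i))"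
  using assms
proof (induction l)
  case (Suc l)
  define h where "h = (\<lambda>t. (g t - g (x i)) / (t - x i))"
  have IH: "divdiff x i (Suc l) g = divdiff x (Suc i) l h"
    unfolding h_def by (rule Suc.IH) (rule inj_on_subset[OF Suc.prems], auto)
  have "divdiff x (Suc i) (Suc l) g = divdiff x (Suc i) (Suc l) (\<lambda>t. g (x i) + (t - x i) * h t)"
  proof (rule divdiff_cong)
    fix k assume "k \<in> {Suc i..Suc i + Suc l}"
    then have "x k \<noteq> x i" using inj_on_contraD[OF Suc.prems, of k i] by simp
    then show "g (x k) = g (x i) + (x k - x i) * h (x k)" by (simp add: h_def)
  qed
  also have "\<dots> = divdiff x (Suc i) (Suc l) (\<lambda>t. (t - x i) * h t)"
    by (simp only: divdiff_add divdiff_const)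
  also have "\<dots> = (x (Suc i + Suc l) - x i) * divdiff x (Suc i) (Suc l) h + divdiff x (Suc i) l h"
    by (rule divdiff_linear_mult) (rule inj_on_subset[OF Suc.prems], auto)
  finally have *: "divdiff x (Suc i) (Suc l) g - divdiff x i (Suc l) g
      = (x (i + Suc (Suc l)) - x i) * divdiff x (Suc i) (Suc l) h"
    using IH by simp
  have "x (i + Suc (Suc l)) - x i \<noteq> 0" using inj_on_contraD[OF Suc.prems, of "i + Suc (Suc l)" i] by simp
  then show ?case
    unfolding divdiff.simps(2)[of x i "Suc l"] * h_def[symmetric] by simp
qed simp

lemma has_derivative_divdiff:
  assumes "\<And>k. k \<in> {i..i + l} \<Longrightarrow> ((\<lambda>\<tau>. G \<tau> (x k)) has_real_derivative G' (x k)) (at \<tau> within S)"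
  shows "((\<lambda>\<tau>. divdiff x i l (G \<tau>)) has_real_derivative divdiff x i l G') (at \<tau> within S)"
  using assms by (induction l arbitrary: i) (auto intro!: DERIV_cdivide DERIV_diff)

text \<open>Induction on the order: with \<open>\<alpha> = x\<^sub>i\<close>, the divided difference is the increment over \<open>[0, 1]\<close> of
  \<open>\<tau> \<mapsto> [x\<^sub>i\<^sub>+\<^sub>1, \<dots>; t \<mapsto> g(\<alpha> + \<tau> (t - \<alpha>)) / (t - \<alpha>)]\<close>, whose derivative is \<open>\<tau> ^ n\<close> times a divided
  difference of \<open>g'\<close> at the contracted points. Comparing with \<open>\<tau> ^ (n + 1)\<close> by Rolle's theorem gives
  the factor \<open>1 / (n + 1)\<close>.\<close>

lemma divdiff_mean_value:
  assumes "deriv_chain {a..b} n D" "inj_on x {i..i + n}" "x ` {i..i + n} \<subseteq> {a..b}"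
  shows "\<exists>\<xi>\<in>{a..b}. divdiff x i n (D 0) = D n \<xi> / fact n"
  using assms
proof (induction n arbitrary: i x D)
  case 0
  then show ?case by auto
next
  case (Suc n)
  define y where "y = (\<lambda>\<tau> k. x i + \<tau> * (x k - x i))"
  define \<Phi> where "\<Phi> = (\<lambda>\<tau>. divdiff x (Suc i) n (\<lambda>t. D 0 (x i + \<tau> * (t - x i)) / (t - x i)))"
  define \<Phi>' where "\<Phi>' = (\<lambda>\<tau>. divdiff x (Suc i) n (\<lambda>t. D 1 (x i + \<tau> * (t - x i))))"
  have xi: "x i \<in> {a..b}" using Suc.prems(3) by (rule subsetD) simp
  have y_in: "y \<tau> k \<in> {a..b}" if "\<tau> \<in> {0..1}" "k \<in> {i..i + Suc n}" for \<tau> k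
  proof -
    have "x k \<in> {a..b}" using Suc.prems(3) that by blast
    then have "(1 - \<tau>) *\<^sub>R x i + \<tau> *\<^sub>R x k \<in> {a..b}"
      using xi that by (intro convexD[OF convex_real_interval(5)]) auto
    then show ?thesis by (simp add: y_def algebra_simps)
  qed
  have ne: "x k \<noteq> x i" if "k \<in> {Suc i..Suc i + n}" for k
    using inj_on_contraD[OF Suc.prems(2), of k i] that by simp
  have der: "(\<Phi> has_real_derivative \<Phi>' \<tau>) (at \<tau> within {0..1})" if "\<tau> \<in> {0..1}" for \<tau>
    unfolding \<Phi>_def \<Phi>'_def
  proof (rule has_derivative_divdiff)
    fix k assume k: "k \<in> {Suc i..Suc i + n}"
    have "(D 0 has_real_derivative D 1 (y \<tau> k)) (at (y \<tau> k) within {a..b})"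
      using deriv_chainD[OF Suc.prems(1), of 0 "y \<tau> k"] y_in[OF that, of k] k by auto
    then have 1: "(D 0 has_real_derivative D 1 (y \<tau> k)) (at (y \<tau> k) within (\<lambda>\<sigma>. y \<sigma> k) ` {0..1})"
      by (rule DERIV_subset) (use y_in k in auto)
    have 2: "((\<lambda>\<sigma>. y \<sigma> k) has_real_derivative (x k - x i)) (at \<tau> within {0..1})"
      unfolding y_def by (auto intro!: derivative_eq_intros)
    have "((\<lambda>\<sigma>. D 0 (y \<sigma> k)) has_real_derivative D 1 (y \<tau> k) * (x k - x i)) (at \<tau> within {0..1})"
      using DERIV_image_chain[OF 1 2] by (simp add: o_def)
    from DERIV_cdivide[OF this, of "x k - x i"] ne[OF k]
    show "((\<lambda>\<tau>. D 0 (x i + \<tau> * (x k - x i)) / (x k - x i)) has_real_derivative D 1 (x i + \<tau> * (x k - x i)))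
        (at \<tau> within {0..1})"
      by (simp add: y_def)
  qed
  define c where "c = \<Phi> 1 - \<Phi> 0"
  define \<Psi> where "\<Psi> = (\<lambda>\<tau>. \<Phi> \<tau> - c * \<tau> ^ Suc n)"
  have derP: "(\<Psi> has_real_derivative (\<Phi>' \<tau> - c * (real (Suc n) * \<tau> ^ n))) (at \<tau> within {0..1})"
    if "\<tau> \<in> {0..1}" for \<tau>
    unfolding \<Psi>_def
    by (rule DERIV_diff[OF der[OF that]], rule DERIV_cmult) (rule derivative_eq_intros | simp)+
  \<comment> \<open>The point \<open>z\<close> lies in the open interval: its positivity keeps the
    contracted nodes distinct and allows \<open>z ^ n\<close> to be cancelled later.\<close>
  have "\<exists>l z. 0 < z \<and> z < (1::real) \<and> (\<Psi> has_real_derivative l) (at z) \<and> \<Psi> 1 - \<Psi> 0 = (1 - 0) * l"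
  proof (rule MVT)
    show "continuous_on {0..1} \<Psi>"
      using derP by (intro DERIV_continuous_on) blast
    fix z :: real assume "0 < z" "z < 1"
    then show "\<Psi> differentiable (at z)"
      using derP[of z] by (simp add: at_within_Icc_at) (auto simp: real_differentiable_def)
  qed simp
  then obtain l z where z: "0 < z" "z < 1" "(\<Psi> has_real_derivative l) (at z)" "\<Psi> 1 - \<Psi> 0 = l"
    by auto
  have "(\<Psi> has_real_derivative (\<Phi>' z - c * (real (Suc n) * z ^ n))) (at z)"
    using derP[of z] z(1,2) by (simp add: at_within_Icc_at)
  with z(3) have "l = \<Phi>' z - c * (real (Suc n) * z ^ n)" by (rule DERIV_unique)
  moreover have "\<Psi> 1 - \<Psi> 0 = 0" by (simp add: \<Psi>_def c_def)
  ultimately have cz: "\<Phi>' z = c * (real (Suc n) * z ^ n)" using z(4) by simp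
  have "\<exists>\<xi>\<in>{a..b}. divdiff (y z) (Suc i) n (D (Suc 0)) = D (Suc n) \<xi> / fact n"
  proof (rule Suc.IH[of "\<lambda>k. D (Suc k)"])
    show "deriv_chain {a..b} n (\<lambda>k. D (Suc k))"
      using Suc.prems(1) by (auto simp: deriv_chain_def)
    show "inj_on (y z) {Suc i..Suc i + n}"
      using Suc.prems(2) z(1) by (auto simp: inj_on_def y_def)
    show "y z ` {Suc i..Suc i + n} \<subseteq> {a..b}"
      using y_in z(1,2) by auto
  qed
  then obtain \<xi> where \<xi>: "\<xi> \<in> {a..b}" "divdiff (y z) (Suc i) n (D 1) = D (Suc n) \<xi> / fact n" by auto
  have "\<Phi>' z = z ^ n * (D (Suc n) \<xi> / fact n)"
    using divdiff_affine[of z x "Suc i" n "D 1" "x i"] z(1) \<xi>(2) by (simp add: \<Phi>'_def y_def)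
  with cz have "z ^ n * (c * real (Suc n)) = z ^ n * (D (Suc n) \<xi> / fact n)"
    by (simp add: mult_ac)
  then have "c * real (Suc n) = D (Suc n) \<xi> / fact n"
    using z(1) by (subst (asm) mult_cancel_left) auto
  then have "c = D (Suc n) \<xi> / fact (Suc n)"
    by (simp add: field_simps del: of_nat_Suc)
  moreover have "divdiff x i (Suc n) (D 0) = c"
  proof -
    have "divdiff x i (Suc n) (D 0) = divdiff x (Suc i) n (\<lambda>t. (D 0 t - D 0 (x i)) / (t - x i))"
      by (rule divdiff_diff_quotient[OF Suc.prems(2)])
    also have "\<dots> = c"
      unfolding c_def \<Phi>_def by (simp add: diff_divide_distrib flip: divdiff_diff)
    finally show ?thesis .
  qed
  ultimately show ?case using \<xi>(1) by auto
qed

section \<open>Mixed partial derivatives and divided differences\<close>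

lemma mixed_pderiv_z:
  assumes f: "has_continuous_pderivs m n {a..b} {c..d} f" and y: "y \<in> {a..b}"
  shows "deriv_chain {c..d} n (\<lambda>j v. mixed_pderiv {a..b} {c..d} 0 j f (y, v))"
  unfolding deriv_chain_def
proof (intro allI impI ballI)
  fix j v assume j: "j < n" and v: "v \<in> {c..d}"
  have "(\<lambda>v. mixed_pderiv {a..b} {c..d} 0 j f (y, v)) differentiable (at v within {c..d})"
    using f y j v by (auto simp: has_continuous_pderivs_def)
  then show "((\<lambda>v. mixed_pderiv {a..b} {c..d} 0 j f (y, v)) has_real_derivative
      mixed_pderiv {a..b} {c..d} 0 (Suc j) f (y, v)) (at v within {c..d})"
    unfolding has_real_derivative_iff_has_vector_derivative vector_derivative_works
    by (simp add: mixed_pderiv_def pderiv_z_def)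
qed

lemma mixed_pderiv_y:
  assumes f: "has_continuous_pderivs m n {a..b} {c..d} f" and j: "j \<le> n" and z: "z \<in> {c..d}"
  shows "deriv_chain {a..b} m (\<lambda>i u. mixed_pderiv {a..b} {c..d} i j f (u, z))"
  unfolding deriv_chain_def
proof (intro allI impI ballI)
  fix i u assume i: "i < m" and u: "u \<in> {a..b}"
  have "(\<lambda>u. mixed_pderiv {a..b} {c..d} i j f (u, z)) differentiable (at u within {a..b})"
    using f i j u z by (auto simp: has_continuous_pderivs_def)
  then show "((\<lambda>u. mixed_pderiv {a..b} {c..d} i j f (u, z)) has_real_derivative
      mixed_pderiv {a..b} {c..d} (Suc i) j f (u, z)) (at u within {a..b})"
    unfolding has_real_derivative_iff_has_vector_derivative vector_derivative_works
    by (simp add: mixed_pderiv_def pderiv_y_def)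
qed

lemma mixed_pderiv_00: "mixed_pderiv I J 0 0 f = f"
  by (simp add: mixed_pderiv_def)

lemma continuous_on_mixed_pderiv:
  "has_continuous_pderivs m n I J f \<Longrightarrow> i \<le> m \<Longrightarrow> j \<le> n \<Longrightarrow> continuous_on (I \<times> J) (mixed_pderiv I J i j f)"
  by (auto simp: has_continuous_pderivs_def)

text \<open>After commuting, the divided difference in \<open>y\<close> is a function of
  \<open>v\<close> whose derivatives are divided differences of the pure
  \<open>z\<close>-derivatives. This yields \<zeta>; the \<open>n\<close>-th
  \<open>z\<close>-derivative at \<zeta> is then differentiated in \<open>y\<close>. The smaller
  rectangle localises the intermediate point.\<close>

lemma divdiff_mean_value_2:
  assumes f: "has_continuous_pderivs m n {a..b} {c..d} f"
    and sub: "{a'..b'} \<subseteq> {a..b}" "{c'..d'} \<subseteq> {c..d}"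
    and y: "inj_on y {0..m}" "y ` {0..m} \<subseteq> {a'..b'}"
    and z: "inj_on z {0..n}" "z ` {0..n} \<subseteq> {c'..d'}"
  shows "\<exists>\<xi>\<in>{a'..b'}. \<exists>\<zeta>\<in>{c'..d'}. divdiff y 0 m (\<lambda>u. divdiff z 0 n (\<lambda>v. f (u, v)))
    = mixed_pderiv {a..b} {c..d} m n f (\<xi>, \<zeta>) / (fact m * fact n)"
proof -
  let ?F = "\<lambda>i j. mixed_pderiv {a..b} {c..d} i j f"
  have yk: "y k \<in> {a..b}" if "k \<in> {0..m}" for k using y(2) sub(1) that by blast
  have "deriv_chain {c'..d'} n (\<lambda>j v. divdiff y 0 m (\<lambda>u. ?F 0 j (u, v)))"
    unfolding deriv_chain_def
  proof (intro allI impI ballI)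
    fix j v assume j: "j < n" and v: "v \<in> {c'..d'}"
    show "((\<lambda>v. divdiff y 0 m (\<lambda>u. ?F 0 j (u, v))) has_real_derivative
        divdiff y 0 m (\<lambda>u. ?F 0 (Suc j) (u, v))) (at v within {c'..d'})"
    proof (rule has_derivative_divdiff)
      fix k assume "k \<in> {0..0 + m}"
      then have "deriv_chain {c'..d'} n (\<lambda>j v. ?F 0 j (y k, v))"
        by (intro deriv_chain_subset[OF mixed_pderiv_z[OF f yk] sub(2)]) auto
      from deriv_chainD[OF this j v]
      show "((\<lambda>v. ?F 0 j (y k, v)) has_real_derivative ?F 0 (Suc j) (y k, v)) (at v within {c'..d'})" .
    qed
  qed
  then obtain \<zeta> where \<zeta>: "\<zeta> \<in> {c'..d'}"
    "divdiff z 0 n (\<lambda>v. divdiff y 0 m (\<lambda>u. ?F 0 0 (u, v))) = divdiff y 0 m (\<lambda>u. ?F 0 n (u, \<zeta>)) / fact n"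
    using divdiff_mean_value[of c' d' n "\<lambda>j v. divdiff y 0 m (\<lambda>u. ?F 0 j (u, v))" z 0] z by auto
  have "deriv_chain {a'..b'} m (\<lambda>i u. ?F i n (u, \<zeta>))"
    using \<zeta>(1) sub by (intro deriv_chain_subset[OF mixed_pderiv_y[OF f]]) auto
  then obtain \<xi> where \<xi>: "\<xi> \<in> {a'..b'}" "divdiff y 0 m (\<lambda>u. ?F 0 n (u, \<zeta>)) = ?F m n (\<xi>, \<zeta>) / fact m"
    using divdiff_mean_value[of a' b' m "\<lambda>i u. ?F i n (u, \<zeta>)" y 0] y by auto
  have "divdiff y 0 m (\<lambda>u. divdiff z 0 n (\<lambda>v. f (u, v))) = ?F m n (\<xi>, \<zeta>) / fact m / fact n"
    using \<zeta>(2) \<xi>(2) by (simp add: divdiff_commute mixed_pderiv_00)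
  then have "divdiff y 0 m (\<lambda>u. divdiff z 0 n (\<lambda>v. f (u, v))) = ?F m n (\<xi>, \<zeta>) / (fact m * fact n)"
    by simp
  then show ?thesis using \<xi>(1) \<zeta>(1) by blast
qed

lemma inj_points_in_interval:
  assumes "a < (b::real)"
  shows "\<exists>x::nat \<Rightarrow> real. inj_on x {0..m} \<and> x ` {0..m} \<subseteq> {a..b}"
proof -
  define x where "x = (\<lambda>k::nat. a + (b - a) * (1 / real (Suc k)))"
  have "inj_on x {0..m}" using assms by (auto simp: inj_on_def x_def)
  moreover have "x k \<in> {a..b}" for k
  proof -
    have "0 \<le> (b - a) * (1 / real (Suc k))" using assms by simp
    moreover have "(b - a) * (1 / real (Suc k)) \<le> (b - a) * 1"
      using assms by (intro mult_left_mono) auto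
    ultimately show ?thesis by (simp add: x_def)
  qed
  ultimately show ?thesis by blast
qed

text \<open>A wrong sign at one point persists nearby by continuity. Nodes chosen in a small
  rectangle there force the intermediate point into the same neighbourhood, against
  convexity.\<close>

lemma nabla_convex_imp_mixed_pderiv:
  assumes f: "has_continuous_pderivs m n {a..b} {c..d} f"
    and conv: "nabla_convex m n {a..b} {c..d} f"
    and "a < b" "c < d" and yz: "y \<in> {a..b}" "z \<in> {c..d}"
  shows "0 \<le> (-1) ^ (m + n) * mixed_pderiv {a..b} {c..d} m n f (y, z)"
proof (rule ccontr)
  define G where "G = (\<lambda>p. (-1) ^ (m + n) * mixed_pderiv {a..b} {c..d} m n f p)"
  assume "\<not> ?thesis"
  then have neg: "G (y, z) < 0" by (simp add: G_def)
  have "continuous_on ({a..b} \<times> {c..d}) G"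
    unfolding G_def by (intro continuous_intros continuous_on_mixed_pderiv[OF f]) auto
  then obtain e where e: "e > 0" "\<And>p. p \<in> {a..b} \<times> {c..d} \<Longrightarrow> dist p (y, z) < e \<Longrightarrow> dist (G p) (G (y, z)) < - G (y, z)"
    using yz neg unfolding continuous_on_iff by (metis SigmaI neg_0_less_iff_less)
  \<comment> \<open>With \<open>e / 3\<close> in each coordinate the sum of the coordinate distances
    is at most two thirds of \<open>e\<close>. Intersecting with the full rectangle covers boundary
    points, and both intervals keep positive length.\<close>
  define a' b' c' d' where "a' = max a (y - e / 3)" "b' = min b (y + e / 3)"
    "c' = max c (z - e / 3)" "d' = min d (z + e / 3)"
  note defs = this
  have lt: "a' < b'" "c' < d'" using assms e(1) by (auto simp: defs)
  obtain ys zs :: "nat \<Rightarrow> real" where ys: "inj_on ys {0..m}" "ys ` {0..m} \<subseteq> {a'..b'}"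
    and zs: "inj_on zs {0..n}" "zs ` {0..n} \<subseteq> {c'..d'}"
    using inj_points_in_interval[OF lt(1)] inj_points_in_interval[OF lt(2)] by meson
  have sub: "{a'..b'} \<subseteq> {a..b}" "{c'..d'} \<subseteq> {c..d}" by (auto simp: defs)
  obtain \<xi> \<zeta> where p: "\<xi> \<in> {a'..b'}" "\<zeta> \<in> {c'..d'}"
    "divdiff ys 0 m (\<lambda>u. divdiff zs 0 n (\<lambda>v. f (u, v))) = mixed_pderiv {a..b} {c..d} m n f (\<xi>, \<zeta>) / (fact m * fact n)"
    using divdiff_mean_value_2[OF f sub ys zs] by blast
  have "0 \<le> (-1) ^ (m + n) * divdiff ys 0 m (\<lambda>u. divdiff zs 0 n (\<lambda>v. f (u, v)))"
    using conv ys zs sub unfolding nabla_convex_def by (meson order_trans)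
  then have "0 \<le> G (\<xi>, \<zeta>) / (fact m * fact n)" by (simp add: p(3) G_def)
  moreover have "(0::real) < fact m * fact n" by simp
  ultimately have nn: "0 \<le> G (\<xi>, \<zeta>)" by (metis divide_neg_pos not_le)
  have "dist (\<xi>, \<zeta>) (y, z) \<le> \<bar>\<xi> - y\<bar> + \<bar>\<zeta> - z\<bar>"
    using sqrt_sum_squares_le_sum_abs by (simp add: dist_Pair_Pair dist_real_def)
  also have "\<dots> < e" using p(1,2) e(1) yz unfolding defs by auto
  finally have "dist (G (\<xi>, \<zeta>)) (G (y, z)) < - G (y, z)"
    using p(1,2) sub by (intro e(2)) auto
  then show False using nn by (auto simp: dist_real_def)
qed

section \<open>Products of one-variable functions as test functions\<close>

lemma divdiff_prod:
  "divdiff y 0 m (\<lambda>u. divdiff z 0 n (\<lambda>v. g u * h v)) = divdiff y 0 m g * divdiff z 0 n h"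
  by (simp add: divdiff_cmult divdiff_cmult_right)

text \<open>The double divided difference factors, so its sign follows from the mean value theorem
  in each variable separately.\<close>

lemma nabla_convex_prod:
  assumes g: "deriv_chain {a..b} m g" and h: "deriv_chain {c..d} n h"
    and g0: "\<And>y. y \<in> {a..b} \<Longrightarrow> 0 \<le> (-1) ^ m * g m y" and h0: "\<And>z. z \<in> {c..d} \<Longrightarrow> 0 \<le> (-1) ^ n * h n z"
  shows "nabla_convex m n {a..b} {c..d} (\<lambda>(y, z). g 0 y * h 0 z)"
  unfolding nabla_convex_def
proof (intro allI impI)
  fix y z :: "nat \<Rightarrow> real"
  assume *: "inj_on y {0..m} \<and> y ` {0..m} \<subseteq> {a..b} \<and> inj_on z {0..n} \<and> z ` {0..n} \<subseteq> {c..d}"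
  obtain \<xi> where \<xi>: "\<xi> \<in> {a..b}" "divdiff y 0 m (g 0) = g m \<xi> / fact m"
    using divdiff_mean_value[OF g, of y 0] * by auto
  obtain \<zeta> where \<zeta>: "\<zeta> \<in> {c..d}" "divdiff z 0 n (h 0) = h n \<zeta> / fact n"
    using divdiff_mean_value[OF h, of z 0] * by auto
  have "0 \<le> (-1) ^ m * g m \<xi> / fact m" using g0[OF \<xi>(1)] by (rule divide_nonneg_pos) simp
  moreover have "0 \<le> (-1) ^ n * h n \<zeta> / fact n" using h0[OF \<zeta>(1)] by (rule divide_nonneg_pos) simp
  ultimately have "0 \<le> ((-1) ^ m * g m \<xi> / fact m) * ((-1) ^ n * h n \<zeta> / fact n)" by (rule mult_nonneg_nonneg)
  then show "0 \<le> (-1) ^ (m + n) * divdiff y 0 m (\<lambda>u. divdiff z 0 n (\<lambda>v. case (u, v) of (y, z) \<Rightarrow> g 0 y * h 0 z))"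
    by (simp add: divdiff_prod \<xi>(2) \<zeta>(2) power_add mult_ac)
qed

text \<open>\<open>vector_derivative\<close> within an interval is determined by a known derivative
  only if the interval is nondegenerate; this is where \<open>a < b\<close> and \<open>c < d\<close>
  enter. The formula for the lower order is known on the interval alone, which suffices for a
  derivative within it.\<close>

lemma mixed_pderiv_prod:
  assumes "a < b" "c < d" and g: "deriv_chain {a..b} m g" and h: "deriv_chain {c..d} n h"
    and "i \<le> m" "j \<le> n" "y \<in> {a..b}" "z \<in> {c..d}"
  shows "mixed_pderiv {a..b} {c..d} i j (\<lambda>(y, z). g 0 y * h 0 z) (y, z) = g i y * h j z"
  using assms(5-)
proof (induction i arbitrary: y z)
  case 0
  from 0(2-) show ?case
  proof (induction j arbitrary: y z)
    case (Suc j)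
    let ?m = "mixed_pderiv {a..b} {c..d} 0 j (\<lambda>(y, z). g 0 y * h 0 z)"
    have 1: "?m (y, v) = g 0 y * h j v" if "v \<in> {c..d}" for v
      using Suc that by auto
    have "(h j has_real_derivative h (Suc j) z) (at z within {c..d})"
      using deriv_chainD[OF h] Suc.prems by auto
    then have "((\<lambda>v. g 0 y * h j v) has_vector_derivative g 0 y * h (Suc j) z) (at z within {c..d})"
      unfolding has_real_derivative_iff_has_vector_derivative[symmetric] by (rule DERIV_cmult)
    then have "((\<lambda>v. ?m (y, v)) has_vector_derivative g 0 y * h (Suc j) z) (at z within {c..d})"
      by (rule has_vector_derivative_transform[rotated 2]) (use 1 Suc.prems in auto)
    from vector_derivative_within_closed_interval[OF \<open>c < d\<close> _ this] Suc.prems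
    show ?case by (simp add: mixed_pderiv_def pderiv_z_def)
  qed (simp add: mixed_pderiv_def)
next
  case (Suc i)
  let ?m = "mixed_pderiv {a..b} {c..d} i j (\<lambda>(y, z). g 0 y * h 0 z)"
  have 1: "?m (u, z) = g i u * h j z" if "u \<in> {a..b}" for u
    using Suc that by auto
  have "(g i has_real_derivative g (Suc i) y) (at y within {a..b})"
    using deriv_chainD[OF g] Suc.prems by auto
  then have "((\<lambda>u. g i u * h j z) has_vector_derivative g (Suc i) y * h j z) (at y within {a..b})"
    unfolding has_real_derivative_iff_has_vector_derivative[symmetric] by (rule DERIV_cmult_right)
  then have "((\<lambda>u. ?m (u, z)) has_vector_derivative g (Suc i) y * h j z) (at y within {a..b})"
    by (rule has_vector_derivative_transform[rotated 2]) (use 1 Suc.prems in auto)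
  from vector_derivative_within_closed_interval[OF \<open>a < b\<close> _ this] Suc.prems
  show ?case by (simp add: mixed_pderiv_def pderiv_y_def)
qed

lemma deriv_chain_continuous:
  assumes "deriv_chain S n D" "continuous_on S (D n)" "k \<le> n"
  shows "continuous_on S (D k)"
proof (cases "k = n")
  case False
  then show ?thesis
    using deriv_chainD[OF assms(1), of k] assms(3) by (intro DERIV_continuous_on) auto
qed (use assms in auto)

lemma has_continuous_pderivs_prod:
  assumes "a < b" "c < d" and g: "deriv_chain {a..b} m g" and h: "deriv_chain {c..d} n h"
    and gc: "continuous_on {a..b} (g m)" and hc: "continuous_on {c..d} (h n)"
  shows "has_continuous_pderivs m n {a..b} {c..d} (\<lambda>(y, z). g 0 y * h 0 z)"
proof -
  let ?m = "\<lambda>i j. mixed_pderiv {a..b} {c..d} i j (\<lambda>(y, z). g 0 y * h 0 z)"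
  note m = mixed_pderiv_prod[OF assms(1-4)]
  have z: "(\<lambda>v. ?m 0 j (y, v)) differentiable (at z within {c..d})"
    if "j < n" "y \<in> {a..b}" "z \<in> {c..d}" for j y z
  proof -
    have "((\<lambda>v. g 0 y * h j v) has_real_derivative g 0 y * h (Suc j) z) (at z within {c..d})"
      using deriv_chainD[OF h] that by (intro DERIV_cmult) auto
    then have "((\<lambda>v. ?m 0 j (y, v)) has_vector_derivative g 0 y * h (Suc j) z) (at z within {c..d})"
      unfolding has_real_derivative_iff_has_vector_derivative
      by (rule has_vector_derivative_transform[rotated 2]) (use m that in auto)
    then show ?thesis by (rule differentiableI_vector)
  qed
  have y: "(\<lambda>u. ?m i j (u, z)) differentiable (at y within {a..b})"
    if "i < m" "j \<le> n" "y \<in> {a..b}" "z \<in> {c..d}" for i j y z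
  proof -
    have "((\<lambda>u. g i u * h j z) has_real_derivative g (Suc i) y * h j z) (at y within {a..b})"
      using deriv_chainD[OF g] that by (intro DERIV_cmult_right) auto
    then have "((\<lambda>u. ?m i j (u, z)) has_vector_derivative g (Suc i) y * h j z) (at y within {a..b})"
      unfolding has_real_derivative_iff_has_vector_derivative
      by (rule has_vector_derivative_transform[rotated 2]) (use m that in auto)
    then show ?thesis by (rule differentiableI_vector)
  qed
  have c: "continuous_on ({a..b} \<times> {c..d}) (?m i j)" if "i \<le> m" "j \<le> n" for i j
  proof -
    have "continuous_on ({a..b} \<times> {c..d}) (\<lambda>p. g i (fst p) * h j (snd p))"
      using deriv_chain_continuous[OF g gc that(1)] deriv_chain_continuous[OF h hc that(2)]
      by (intro continuous_on_mult continuous_on_compose2[of _ "g i" _ fst] continuous_on_compose2[of _ "h j" _ snd])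
        (auto intro: continuous_intros)
    then show ?thesis
      by (subst continuous_on_cong[OF refl, where g="\<lambda>p. g i (fst p) * h j (snd p)"]) (use m that in auto)
  qed
  show ?thesis unfolding has_continuous_pderivs_def using z y c by blast
qed

section \<open>Truncated powers\<close>

text \<open>The case distinction matters for \<open>M = 0\<close>: the function is then the
  indicator of \<open>y \<le> s\<close>, with value 1 at \<open>y = s\<close> because
  \<open>0 ^ 0 = 1\<close>.\<close>

definition truncated_power :: "nat \<Rightarrow> real \<Rightarrow> real \<Rightarrow> real" where
  "truncated_power M s y = (if y \<le> s then (s - y) ^ M / fact M else 0)"

text \<open>The expansion at the left endpoint is applied to the reflected function
  \<open>E\<close>, whence the alternating signs. In the remainder the kernel does the cutting off,
  so the domain {a..b} no longer depends on \<open>y\<close> and the order of integration can be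
  exchanged later.\<close>

lemma taylor_truncated_power:
  assumes D: "deriv_chain {a..b} (Suc M) D" and cont: "continuous_on {a..b} (D (Suc M))"
    and y: "y \<in> {a..b}"
  shows "D 0 y = (\<Sum>i\<le>M. (-1) ^ i * D i b * truncated_power i b y) +
    (LINT s|lborel. indicator {a..b} s * ((-1) ^ Suc M * D (Suc M) s) * truncated_power M s y)"
proof -
  define E where "E = (\<lambda>k x. (-1) ^ k * D k (- x))"
  define \<phi> where "\<phi> = (\<lambda>s. ((s - y) ^ M / fact M) * ((-1) ^ Suc M * D (Suc M) s))"
  have "((\<lambda>x. ((- y - x) ^ (Suc M - 1) / fact (Suc M - 1)) *\<^sub>R E (Suc M) x) has_integral
      E 0 (- y) - (\<Sum>i<Suc M. ((- y - - b) ^ i / fact i) *\<^sub>R E i (- b))) {- b..- y}"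
  proof (rule Taylor_has_integral)
    fix k t assume k: "k < Suc M" and t: "- b \<le> t" "t \<le> - y"
    have "(D k has_real_derivative D (Suc k) (- t)) (at (- t) within {a..b})"
      using deriv_chainD[OF D k, of "- t"] t y by auto
    then have "(D k has_real_derivative D (Suc k) (- t)) (at (- t) within uminus ` {- b..- y})"
      by (rule DERIV_subset) (use y in auto)
    moreover have "(uminus has_real_derivative - 1) (at t within {- b..- y})"
      by (auto intro!: derivative_eq_intros)
    ultimately have "((D k \<circ> uminus) has_real_derivative D (Suc k) (- t) * (- 1)) (at t within {- b..- y})"
      by (rule DERIV_image_chain)
    from DERIV_cmult[OF this, of "(-1) ^ k"]
    show "(E k has_vector_derivative E (Suc k) t) (at t within {- b..- y})"
      by (simp add: E_def o_def has_real_derivative_iff_has_vector_derivative)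
  qed (use y in auto)
  then have "((\<lambda>x. \<phi> (- x)) has_integral D 0 y - (\<Sum>i\<le>M. (-1) ^ i * D i b * ((b - y) ^ i / fact i))) {- b..- y}"
    by (simp add: E_def \<phi>_def lessThan_Suc_atMost algebra_simps minus_diff_commute[of y])
  then have "(\<phi> has_integral D 0 y - (\<Sum>i\<le>M. (-1) ^ i * D i b * ((b - y) ^ i / fact i))) {y..b}"
    by (simp only: has_integral_reflect_real)
  moreover have "(LINT s:{y..b}|lborel. \<phi> s) = integral {y..b} \<phi>"
  proof (rule set_borel_integral_eq_integral(2)[OF borel_integrable_atLeastAtMost'])
    show "continuous_on {y..b} \<phi>"
      unfolding \<phi>_def using y by (intro continuous_intros continuous_on_subset[OF cont]) auto
  qed
  moreover have "(LINT s:{y..b}|lborel. \<phi> s)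
      = (LINT s|lborel. indicator {a..b} s * ((-1) ^ Suc M * D (Suc M) s) * truncated_power M s y)"
    unfolding set_lebesgue_integral_def
    by (rule Bochner_Integration.integral_cong)
      (use y in \<open>auto simp: \<phi>_def truncated_power_def indicator_def\<close>)
  ultimately show ?thesis using y by (simp add: integral_unique truncated_power_def)
qed

lemma truncated_power_measurable [measurable]:
  "(\<lambda>x. truncated_power M (f x) (g x)) \<in> borel_measurable N"
  if [measurable]: "f \<in> borel_measurable N" "g \<in> borel_measurable N" for f g :: "_ \<Rightarrow> real"
  unfolding truncated_power_def by measurable

lemma truncated_power_nonneg: "0 \<le> truncated_power M s y"
  by (auto simp: truncated_power_def)

lemma truncated_power_le:
  assumes "y \<in> {a..b}" "s \<in> {a..b}"
  shows "truncated_power M s y \<le> (b - a) ^ M / fact M"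
  using assms by (auto simp: truncated_power_def intro!: divide_right_mono power_mono)

section \<open>Smooth approximation of the truncated powers\<close>

text \<open>For positive \<open>k\<close> this is the truncated power as a function of
  \<open>u = s - y\<close>, but \<open>ramp 0\<close> is constantly 1. Index 0 occurs only in upper
  bounds; differentiation stops at \<open>ramp 1\<close>.\<close>

definition ramp :: "nat \<Rightarrow> real \<Rightarrow> real" where
  "ramp k u = max 0 u ^ k / fact k"

lemma continuous_ramp: "continuous_on S (ramp k)"
  unfolding ramp_def by (intro continuous_intros) auto

text \<open>At 0 the difference quotient is a positive power of \<open>max 0 h\<close> up to a
  constant, so it tends to 0. Starting from index 2 avoids the corner of
  \<open>ramp 1\<close>.\<close>

lemma DERIV_ramp: "(ramp (Suc (Suc k)) has_real_derivative ramp (Suc k) u) (at u)"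
proof -
  consider "u < 0" | "u = 0" | "u > 0" by linarith
  then show ?thesis
  proof cases
    case 1
    have "(ramp (Suc (Suc k)) has_real_derivative 0) (at u) \<longleftrightarrow> ((\<lambda>_. 0) has_real_derivative 0) (at u)"
    proof (rule DERIV_cong_ev[OF refl _ refl])
      show "\<forall>\<^sub>F x in nhds u. ramp (Suc (Suc k)) x = 0"
        using eventually_nhds_in_open[of "{..<0}" u] 1 by (auto elim!: eventually_mono simp: ramp_def)
    qed
    then show ?thesis using 1 by (simp add: ramp_def)
  next
    case 2
    have "((\<lambda>h. max 0 h ^ Suc k / fact (Suc (Suc k))) \<longlongrightarrow> max 0 0 ^ Suc k / fact (Suc (Suc k))) (at (0::real))"
      by (intro tendsto_intros) auto
    moreover have "(ramp (Suc (Suc k)) (u + h) - ramp (Suc (Suc k)) u) / h = max 0 h ^ Suc k / fact (Suc (Suc k))"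
      if "h \<noteq> 0" for h
      using that 2 by (cases "h > 0") (auto simp: ramp_def simp del: fact_Suc)
    ultimately show ?thesis
      unfolding DERIV_def
      by (subst tendsto_cong[where g="\<lambda>h. max 0 h ^ Suc k / fact (Suc (Suc k))"])
        (auto simp: eventually_at_filter ramp_def 2)
  next
    case 3
    have "(ramp (Suc (Suc k)) has_real_derivative ramp (Suc k) u) (at u) \<longleftrightarrow>
      ((\<lambda>x. x ^ Suc (Suc k) / fact (Suc (Suc k))) has_real_derivative u ^ Suc k / fact (Suc k)) (at u)"
    proof (rule DERIV_cong_ev[OF refl])
      show "\<forall>\<^sub>F x in nhds u. ramp (Suc (Suc k)) x = x ^ Suc (Suc k) / fact (Suc (Suc k))"
        using eventually_nhds_in_open[of "{0<..}" u] 3 by (auto elim!: eventually_mono simp: ramp_def)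
      show "ramp (Suc k) u = u ^ Suc k / fact (Suc k)" using 3 by (simp add: ramp_def)
    qed
    moreover have "((\<lambda>x. x ^ Suc (Suc k) / fact (Suc (Suc k))) has_real_derivative
       (real (Suc (Suc k)) * u ^ Suc k) / fact (Suc (Suc k))) (at u)"
      by (rule DERIV_cdivide) (use DERIV_pow[of "Suc (Suc k)" u] in simp)
    moreover have "(real (Suc (Suc k)) * u ^ Suc k) / fact (Suc (Suc k)) = u ^ Suc k / fact (Suc k)"
      by (simp only: fact_Suc[of "Suc k"] of_nat_mult) (simp del: fact_Suc of_nat_Suc)
    ultimately show ?thesis by simp
  qed
qed

text \<open>The mean value theorem would fail for \<open>M = 0\<close>, where \<open>ramp 1\<close>
  has a corner. Instead, p ^ (M + 1) - q ^ (M + 1) is factored for the positive parts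
  \<open>p\<close> and \<open>q\<close>, and each of the \<open>M + 1\<close> summands of the
  cofactor lies between \<open>q ^ M\<close> and \<open>p ^ M\<close>.\<close>

lemma ramp_increment:
  assumes "0 \<le> h"
  shows "ramp (Suc M) (x + h) - ramp (Suc M) x \<le> h * ramp M (x + h)"
    and "0 \<le> ramp (Suc M) (x + h) - ramp (Suc M) x"
    and "0 \<le> x \<Longrightarrow> h * (x ^ M / fact M) \<le> ramp (Suc M) (x + h) - ramp (Suc M) x"
proof -
  define p q where "p = max 0 (x + h)" and "q = max 0 x"
  have pq: "0 \<le> q" "q \<le> p" "p - q \<le> h" using assms by (auto simp: p_def q_def)
  have "p ^ Suc M - q ^ Suc M = (p - q) * (\<Sum>i<Suc M. p ^ i * q ^ (M - i))"
    using diff_power_eq_sum[of p M q] by simp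
  moreover have "(\<Sum>i<Suc M. p ^ i * q ^ (M - i)) \<le> (\<Sum>i<Suc M. p ^ M)"
  proof (rule sum_mono)
    fix i assume i: "i \<in> {..<Suc M}"
    have "p ^ i * q ^ (M - i) \<le> p ^ i * p ^ (M - i)"
      using pq by (intro mult_left_mono power_mono) auto
    then show "p ^ i * q ^ (M - i) \<le> p ^ M" using i by (simp flip: power_add)
  qed
  moreover have "(\<Sum>i<Suc M. q ^ M) \<le> (\<Sum>i<Suc M. p ^ i * q ^ (M - i))"
  proof (rule sum_mono)
    fix i assume i: "i \<in> {..<Suc M}"
    have "q ^ i * q ^ (M - i) \<le> p ^ i * q ^ (M - i)"
      using pq by (intro mult_right_mono power_mono) auto
    then show "q ^ M \<le> p ^ i * q ^ (M - i)" using i by (simp flip: power_add)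
  qed
  ultimately have up: "p ^ Suc M - q ^ Suc M \<le> (p - q) * (real (Suc M) * p ^ M)"
    and lo: "(p - q) * (real (Suc M) * q ^ M) \<le> p ^ Suc M - q ^ Suc M"
    using pq by (auto intro!: mult_left_mono simp del: power_Suc)
  have f: "z * (real (Suc M) * w) / fact (Suc M) = z * (w / fact M)" for z w :: real
    by (simp del: of_nat_Suc)
  have d: "ramp (Suc M) (x + h) - ramp (Suc M) x = (p ^ Suc M - q ^ Suc M) / fact (Suc M)"
    by (simp add: ramp_def p_def q_def diff_divide_distrib)
  have "(p ^ Suc M - q ^ Suc M) / fact (Suc M) \<le> (p - q) * (p ^ M / fact M)"
    using divide_right_mono[OF up, of "fact (Suc M)"] by (simp only: f fact_ge_zero)
  also have "\<dots> \<le> h * (p ^ M / fact M)"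
    using pq by (intro mult_right_mono) auto
  finally show "ramp (Suc M) (x + h) - ramp (Suc M) x \<le> h * ramp M (x + h)"
    unfolding d by (simp add: ramp_def p_def)
  show "0 \<le> ramp (Suc M) (x + h) - ramp (Suc M) x"
    unfolding d using pq by (intro divide_nonneg_nonneg) (auto simp del: power_Suc intro!: power_mono)
  assume "0 \<le> x"
  then have "p - q = h" "q = x" using assms by (auto simp: p_def q_def)
  then show "h * (x ^ M / fact M) \<le> ramp (Suc M) (x + h) - ramp (Suc M) x"
    unfolding d using divide_right_mono[OF lo, of "fact (Suc M)"] by (simp only: f fact_ge_zero)
qed

text \<open>A forward difference, not a centred one: for \<open>k = 2\<close> and
  \<open>u = 0\<close> it equals 1, the value of the truncated power at its jump, whereas the
  centred one would give 1/2.\<close>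

definition second_diff :: "nat \<Rightarrow> real \<Rightarrow> real \<Rightarrow> real" where
  "second_diff k h u = (ramp k (u + 2 * h) - 2 * ramp k (u + h) + ramp k u) / h\<^sup>2"

text \<open>One application of the mean value theorem leaves an increment of
  \<open>ramp (Suc M)\<close>; from there \<open>ramp_increment\<close> takes over, which tolerates
  the corner occurring for \<open>M = 0\<close>.\<close>

lemma second_diff_bounds:
  assumes h: "0 < h"
  shows "0 \<le> second_diff (Suc (Suc M)) h u"
    and "second_diff (Suc (Suc M)) h u \<le> ramp M (u + 2 * h)"
    and "0 \<le> u \<Longrightarrow> u ^ M / fact M \<le> second_diff (Suc (Suc M)) h u"
proof -
  let ?R = "ramp (Suc (Suc M))"
  have "\<exists>\<xi>>u. \<xi> < u + h \<and> (?R (u + h + h) - ?R (u + h)) - (?R (u + h) - ?R u)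
      = (u + h - u) * (ramp (Suc M) (\<xi> + h) - ramp (Suc M) \<xi>)"
  proof (rule MVT2)
    fix x
    have "((\<lambda>x. ?R (x + h)) has_real_derivative ramp (Suc M) (x + h)) (at x)"
      using DERIV_ramp[of M "x + h"] by (simp only: DERIV_shift)
    then show "((\<lambda>x. ?R (x + h) - ?R x) has_real_derivative ramp (Suc M) (x + h) - ramp (Suc M) x) (at x)"
      by (intro DERIV_diff DERIV_ramp)
  qed (use h in auto)
  then obtain \<xi> where \<xi>: "u < \<xi>" "\<xi> < u + h"
    and e: "(?R (u + h + h) - ?R (u + h)) - (?R (u + h) - ?R u) = h * (ramp (Suc M) (\<xi> + h) - ramp (Suc M) \<xi>)"
    by auto
  have "?R (u + 2 * h) - 2 * ?R (u + h) + ?R u = h * (ramp (Suc M) (\<xi> + h) - ramp (Suc M) \<xi>)"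
    unfolding e[symmetric] by (simp add: algebra_simps)
  then have eq: "second_diff (Suc (Suc M)) h u = (ramp (Suc M) (\<xi> + h) - ramp (Suc M) \<xi>) / h"
    using h by (simp add: second_diff_def power2_eq_square)
  show "0 \<le> second_diff (Suc (Suc M)) h u"
    unfolding eq using h ramp_increment(2)[of h M \<xi>] by simp
  have "second_diff (Suc (Suc M)) h u \<le> ramp M (\<xi> + h)"
    unfolding eq using h ramp_increment(1)[of h M \<xi>] by (simp add: field_simps)
  also have "\<dots> \<le> ramp M (u + 2 * h)"
    unfolding ramp_def using \<xi> by (intro divide_right_mono power_mono) auto
  finally show "second_diff (Suc (Suc M)) h u \<le> ramp M (u + 2 * h)" .
  assume u: "0 \<le> u"
  have "u ^ M / fact M \<le> \<xi> ^ M / fact M"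
    using u \<xi> by (intro divide_right_mono power_mono) auto
  also have "\<dots> \<le> second_diff (Suc (Suc M)) h u"
    unfolding eq using h ramp_increment(3)[of h \<xi> M] u \<xi> by (simp add: field_simps)
  finally show "u ^ M / fact M \<le> second_diff (Suc (Suc M)) h u" .
qed

text \<open>Convexity of the positive part. It provides the sign of the top derivative of the
  approximations.\<close>

lemma second_diff_1_nonneg: "0 < h \<Longrightarrow> 0 \<le> second_diff (Suc 0) h u"
  unfolding second_diff_def by (intro divide_nonneg_nonneg) (auto simp: ramp_def max_def)

text \<open>Convergence holds at every \<open>y\<close>, also at the jump: for
  \<open>y \<le> s\<close> the quotient is squeezed between the kernel and a shifted power.\<close>

lemma second_diff_tendsto:
  assumes h: "\<And>n. 0 < h n" "h \<longlonglongrightarrow> 0"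
  shows "(\<lambda>n. second_diff (Suc (Suc M)) (h n) (s - y)) \<longlonglongrightarrow> truncated_power M s y"
proof (cases "y \<le> s")
  case True
  define u where "u = s - y"
  have u: "0 \<le> u" using True by (simp add: u_def)
  have "(\<lambda>n. (u + 2 * h n) ^ M / fact M) \<longlonglongrightarrow> (u + 2 * 0) ^ M / fact M"
    by (intro tendsto_intros h(2)) auto
  then have lim: "(\<lambda>n. (u + 2 * h n) ^ M / fact M) \<longlonglongrightarrow> u ^ M / fact M" by simp
  have "(\<lambda>n. second_diff (Suc (Suc M)) (h n) u) \<longlonglongrightarrow> u ^ M / fact M"
  proof (rule tendsto_sandwich[OF _ _ tendsto_const lim])
    show "\<forall>\<^sub>F n in sequentially. u ^ M / fact M \<le> second_diff (Suc (Suc M)) (h n) u"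
      using second_diff_bounds(3)[OF h(1) u] by simp
    show "\<forall>\<^sub>F n in sequentially. second_diff (Suc (Suc M)) (h n) u \<le> (u + 2 * h n) ^ M / fact M"
    proof (rule always_eventually, rule allI)
      fix n show "second_diff (Suc (Suc M)) (h n) u \<le> (u + 2 * h n) ^ M / fact M"
        using second_diff_bounds(2)[OF h(1)[of n], of M u] u h(1)[of n] by (simp add: ramp_def max_def)
    qed
  qed
  then show ?thesis using True by (simp add: truncated_power_def u_def)
next
  case False
  \<comment> \<open>From here on even the rightmost node \<open>s - y + 2 * h n\<close> is negative,
    and all three ramps vanish.\<close>
  have "\<forall>\<^sub>F n in sequentially. h n < (y - s) / 2"
    using order_tendstoD(2)[OF h(2), of "(y - s) / 2"] False by simp
  then have "\<forall>\<^sub>F n in sequentially. second_diff (Suc (Suc M)) (h n) (s - y) = 0"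
  proof eventually_elim
    case (elim n)
    then show ?case using h(1)[of n] by (simp add: second_diff_def ramp_def)
  qed
  then show ?thesis using False by (simp add: truncated_power_def tendsto_eventually)
qed

text \<open>Each derivative in \<open>y\<close> lowers the ramp index and changes the sign. After
  \<open>M + 1\<close> of them index 1 remains, still continuous and with nonnegative second
  differences; hence the starting index \<open>M + 2\<close>.\<close>

lemma deriv_chain_second_diff:
  "deriv_chain UNIV (Suc M) (\<lambda>k y. (-1) ^ k * second_diff (Suc (Suc M) - k) h (s - y))"
  unfolding deriv_chain_def
proof (intro allI impI ballI)
  fix k x assume k: "k < Suc M"
  then obtain m where m: "Suc (Suc M) - k = Suc (Suc m)" "Suc (Suc M) - Suc k = Suc m"
    by (metis Suc_diff_Suc diff_Suc_Suc less_SucI)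
  have r: "((\<lambda>y. ramp (Suc (Suc m)) (s - y + c)) has_real_derivative ramp (Suc m) (s - x + c) * (- 1)) (at x)" for c
    by (rule DERIV_chain2[OF DERIV_ramp]) (auto intro!: derivative_eq_intros)
  have "((\<lambda>y. second_diff (Suc (Suc m)) h (s - y)) has_real_derivative
     (ramp (Suc m) (s - x + 2 * h) * (- 1) - 2 * (ramp (Suc m) (s - x + h) * (- 1)) + ramp (Suc m) (s - x + 0) * (- 1)) / h\<^sup>2) (at x)"
    unfolding second_diff_def
    by (rule DERIV_cdivide, rule DERIV_add[OF DERIV_diff[OF r DERIV_cmult[OF r]]]) (use r[of 0] in simp)
  then have "((\<lambda>y. second_diff (Suc (Suc m)) h (s - y)) has_real_derivative - second_diff (Suc m) h (s - x)) (at x)"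
    by (rule DERIV_cong, unfold second_diff_def minus_divide_left) (rule arg_cong[where f="\<lambda>q. q / h\<^sup>2"], simp)
  from DERIV_cmult[OF this, of "(-1) ^ k"]
  show "((\<lambda>y. (- 1) ^ k * second_diff (Suc (Suc M) - k) h (s - y)) has_real_derivative
      (- 1) ^ Suc k * second_diff (Suc (Suc M) - Suc k) h (s - x)) (at x within UNIV)"
    unfolding m by simp
qed

lemma continuous_second_diff: "continuous_on S (\<lambda>y. second_diff k h (s - y))"
  unfolding second_diff_def
  by (cases "h = 0") (auto intro!: continuous_intros continuous_on_compose2[OF continuous_ramp[of UNIV]])

text \<open>Bounded pointwise limits of smooth one-variable functions of the sign class that makes products
  \<open>\<nabla>\<close>-convex. Both signs of the powers belong to it, because their top derivative vanishes.\<close>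

definition cone_limit :: "nat \<Rightarrow> real set \<Rightarrow> (real \<Rightarrow> real) \<Rightarrow> bool" where
  "cone_limit m S u \<longleftrightarrow> (\<exists>G.
    (\<forall>n. deriv_chain UNIV m (G n) \<and> continuous_on UNIV (G n m) \<and> (\<forall>y\<in>S. 0 \<le> (-1) ^ m * G n m y)) \<and>
    (\<exists>C. \<forall>n. \<forall>y\<in>S. \<bar>G n 0 y\<bar> \<le> C) \<and> (\<forall>y\<in>S. (\<lambda>n. G n 0 y) \<longlonglongrightarrow> u y))"

lemma cone_limit_truncated_power:
  assumes "s \<in> {a..b}"
  shows "cone_limit (Suc M) {a..b} (truncated_power M s)"
proof -
  define h where "h = (\<lambda>n. 1 / real (Suc n))"
  have h: "0 < h n" "h n \<le> 1" for n by (auto simp: h_def)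
  have h0: "h \<longlonglongrightarrow> 0" unfolding h_def using LIMSEQ_inverse_real_of_nat by (simp add: divide_inverse)
  define G where "G = (\<lambda>n k y. (-1) ^ k * second_diff (Suc (Suc M) - k) (h n) (s - y))"
  have "deriv_chain UNIV (Suc M) (G n)" for n
    unfolding G_def by (rule deriv_chain_second_diff)
  moreover have "continuous_on UNIV (G n (Suc M))" for n
    unfolding G_def by (intro continuous_on_mult continuous_on_const continuous_second_diff)
  moreover have "0 \<le> (-1) ^ Suc M * G n (Suc M) y" for n y
    using second_diff_1_nonneg[OF h(1)[of n], of "s - y"] by (simp add: G_def flip: power_add mult.assoc)
  moreover have "\<bar>G n 0 y\<bar> \<le> (b - a + 2) ^ M / fact M" if "y \<in> {a..b}" for n y
  proof -
    \<comment> \<open>The constant comes from \<open>s - y \<le> b - a\<close> and step sizes at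
      most 1.\<close>
    have "ramp M (s - y + 2 * h n) \<le> (b - a + 2) ^ M / fact M"
      unfolding ramp_def using assms that h[of n] by (intro divide_right_mono power_mono) auto
    then show ?thesis
      using second_diff_bounds(1,2)[OF h(1)[of n], of M "s - y"] by (simp add: G_def)
  qed
  moreover have "(\<lambda>n. G n 0 y) \<longlonglongrightarrow> truncated_power M s y" for y
    unfolding G_def using second_diff_tendsto[OF h(1) h0] by simp
  ultimately show ?thesis unfolding cone_limit_def by blast
qed

text \<open>A constant sequence does it: on {a..b} truncation at \<open>b\<close> is never active,
  so the function is a polynomial there.\<close>

lemma cone_limit_monomial:
  assumes "i \<le> M"
  shows "cone_limit (Suc M) {a..b} (\<lambda>y. \<epsilon> * truncated_power i b y)"
proof -
  define G where "G = (\<lambda>k y. \<epsilon> * (if k \<le> i then (-1) ^ k * (b - y) ^ (i - k) / fact (i - k) else 0))"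
  have "(G k has_real_derivative G (Suc k) x) (at x)" for k x
  proof -
    consider "k < i" | "k = i" | "i < k" by linarith
    then show ?thesis
    proof cases
      case 1
      then obtain m where m: "i - k = Suc m" "i - Suc k = m" by (metis Suc_diff_Suc)
      have "((\<lambda>y. (b - y) ^ Suc m) has_real_derivative - (real (Suc m) * (b - x) ^ m)) (at x)"
        by (rule derivative_eq_intros | simp)+
      from DERIV_cdivide[OF DERIV_cmult[OF this, of "\<epsilon> * (-1) ^ k"], of "fact (Suc m)"]
      show ?thesis using 1 by (simp add: G_def m divide_simps del: of_nat_Suc) (simp add: algebra_simps del: of_nat_Suc)
    qed (auto simp: G_def[abs_def])
  qed
  then have "deriv_chain UNIV (Suc M) G" by (simp add: deriv_chain_def)
  moreover have "G (Suc M) = (\<lambda>_. 0)" using assms by (auto simp: G_def)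
  moreover have "\<exists>C. \<forall>y\<in>{a..b}. \<bar>G 0 y\<bar> \<le> C"
  proof -
    have "continuous_on {a..b} (G 0)" unfolding G_def by (auto intro!: continuous_intros)
    then have "bounded (G 0 ` {a..b})" by (intro compact_imp_bounded compact_continuous_image) auto
    then show ?thesis by (auto simp: bounded_iff)
  qed
  moreover have "G 0 y = \<epsilon> * truncated_power i b y" if "y \<in> {a..b}" for y
    using that by (simp add: G_def truncated_power_def)
  ultimately show ?thesis unfolding cone_limit_def by (intro exI[of _ "\<lambda>n. G"]) auto
qed

section \<open>Integrating the Taylor formula\<close>

text \<open>The bound is required only where \<open>Q\<close> is nonzero, since kernels and
  derivatives are controlled on the rectangle alone.\<close>

lemma integrable_mult_bounded:
  fixes Q g :: "'a \<Rightarrow> real"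
  assumes "integrable M Q" "g \<in> borel_measurable M" "\<And>x. Q x \<noteq> 0 \<Longrightarrow> \<bar>g x\<bar> \<le> C"
  shows "integrable M (\<lambda>x. Q x * g x)"
proof (rule Bochner_Integration.integrable_bound)
  show "integrable M (\<lambda>x. C * Q x)" using assms(1) by simp
  show "AE x in M. norm (Q x * g x) \<le> norm (C * Q x)"
  proof (rule AE_I2)
    fix x show "norm (Q x * g x) \<le> norm (C * Q x)"
      using assms(3)[of x] by (cases "Q x = 0") (auto simp: abs_mult mult.commute intro!: mult_right_mono)
  qed
qed (use assms in measurable)

text \<open>Transfers the iterated integrals of \<open>P\<close> to one Lebesgue integral against a
  Borel weight. \<open>Q\<close> is a Borel version of \<open>P\<close> cut off outside the
  rectangle; Fubini applies to \<open>Q\<close>, and changes on null sets do not affect the gauge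
  integrals.\<close>

lemma borel_representation:
  fixes P :: "real \<times> real \<Rightarrow> real"
  assumes P: "P absolutely_integrable_on ({a..b} \<times> {c..d})"
  obtains Q where "integrable lborel Q" "\<And>x. x \<notin> {a..b} \<times> {c..d} \<Longrightarrow> Q x = 0"
    "\<forall>g\<in>borel_measurable borel. \<forall>C. (\<forall>x\<in>{a..b} \<times> {c..d}. \<bar>g x\<bar> \<le> C) \<longrightarrow>
      integral {a..b} (\<lambda>y. integral {c..d} (\<lambda>z. P (y, z) * g (y, z))) = (LINT x|lborel. Q x * g x)"
proof -
  let ?R = "{a..b} \<times> {c..d}"
  have iP: "integrable lebesgue (\<lambda>x. indicator ?R x * P x)"
    using P by (simp add: set_integrable_def)
  obtain Q0 where Q0: "Q0 \<in> borel_measurable lborel" "AE x in lborel. indicator ?R x * P x = Q0 x"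
    using completion_ex_borel_measurable_real[OF borel_measurable_integrable[OF iP]] by auto
  define Q where "Q = (\<lambda>x. indicator ?R x * Q0 x)"
  have R[measurable]: "?R \<in> sets borel" by (intro borel_closed closed_Times) auto
  have Qm[measurable]: "Q \<in> borel_measurable borel"
    using Q0(1) unfolding Q_def by measurable
  have ae: "AE x in lborel. indicator ?R x * P x = Q x"
    using Q0(2)
  proof eventually_elim
    case (elim x)
    then show ?case by (cases "x \<in> ?R") (simp_all add: Q_def)
  qed
  have "integrable lebesgue Q"
    using iP
    by (rule integrable_cong_AE_imp) (use Qm AE_completion[OF ae] in \<open>auto intro: measurable_completion\<close>)
  then have iQ: "integrable lborel Q" by (simp add: integrable_completion)
  have Q_out: "Q x = 0" if "x \<notin> ?R" for x using that by (simp add: Q_def)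
  have rep: "\<forall>g\<in>borel_measurable borel. \<forall>C. (\<forall>x\<in>?R. \<bar>g x\<bar> \<le> C) \<longrightarrow>
      integral {a..b} (\<lambda>y. integral {c..d} (\<lambda>z. P (y, z) * g (y, z))) = (LINT x|lborel. Q x * g x)"
  proof (intro ballI allI impI)
    fix g :: "real \<times> real \<Rightarrow> real" and C
    assume gm[measurable]: "g \<in> borel_measurable borel" and C: "\<forall>x\<in>?R. \<bar>g x\<bar> \<le> C"
    have "integrable lborel (\<lambda>x. Q x * g x)"
      by (rule integrable_mult_bounded[OF iQ]) (use C Q_out in auto)
    then have int: "integrable (lborel \<Otimes>\<^sub>M lborel) (\<lambda>x. Q x * g x)" by (simp add: lborel_prod)
    \<comment> \<open>For almost every \<open>y\<close> the two sections agree almost everywhere.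
      For the remaining \<open>y\<close> nothing is known about the inner integral of
      \<open>P\<close>, but the outer integral ignores them.\<close>
    have 1: "AE y in lborel. AE z in lborel. indicator ?R (y, z) * P (y, z) = Q (y, z)"
    proof (rule lborel_pair.AE_pair[of "\<lambda>x. indicator ?R x * P x = Q x"])
      show "AE x in lborel \<Otimes>\<^sub>M lborel. indicator ?R x * P x = Q x"
        unfolding lborel_prod by (rule ae)
    qed
    have 2: "AE y in lborel. integrable lborel (\<lambda>z. Q (y, z) * g (y, z))"
      using lborel_pair.AE_integrable_fst'[OF int] by simp
    have inner: "AE y in lborel. (LINT z|lborel. Q (y, z) * g (y, z)) =
        (if y \<in> {a..b} then integral {c..d} (\<lambda>z. P (y, z) * g (y, z)) else 0)"
      using 1 2
    proof eventually_elim
      case (elim y)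
      show ?case
      proof (cases "y \<in> {a..b}")
        case True
        have hi: "((\<lambda>z. Q (y, z) * g (y, z)) has_integral (LINT z|lborel. Q (y, z) * g (y, z))) UNIV"
          by (rule has_integral_integral_lborel[OF elim(2)])
        have hae: "AE z in lborel. z \<in> UNIV \<longrightarrow>
            Q (y, z) * g (y, z) = (if z \<in> {c..d} then P (y, z) * g (y, z) else 0)"
          using elim(1) by eventually_elim (use True in \<open>auto simp: indicator_def split: if_splits\<close>)
        have "((\<lambda>z. if z \<in> {c..d} then P (y, z) * g (y, z) else 0)
            has_integral (LINT z|lborel. Q (y, z) * g (y, z))) UNIV"
          by (rule has_integral_AE[OF hae, THEN iffD1, OF hi])
        then show ?thesis using True by (simp only: has_integral_restrict_UNIV integral_unique if_True)
      next
        case False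
        then have "Q (y, z) = 0" for z by (intro Q_out) auto
        then show ?thesis using False by (simp only: if_False) simp
      qed
    qed
    have "((\<lambda>y. LINT z|lborel. Q (y, z) * g (y, z)) has_integral
        (LINT y|lborel. LINT z|lborel. Q (y, z) * g (y, z))) UNIV"
      using lborel_pair.integrable_fst'[OF int] by (intro has_integral_integral_lborel) simp
    also have "(LINT y|lborel. LINT z|lborel. Q (y, z) * g (y, z)) = (LINT x|lborel. Q x * g x)"
      using lborel_pair.integral_fst'[OF int] by (simp add: lborel_prod)
    finally have outer: "((\<lambda>y. LINT z|lborel. Q (y, z) * g (y, z)) has_integral (LINT x|lborel. Q x * g x)) UNIV" .
    have "AE y in lborel. y \<in> UNIV \<longrightarrow> (LINT z|lborel. Q (y, z) * g (y, z)) =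
        (if y \<in> {a..b} then integral {c..d} (\<lambda>z. P (y, z) * g (y, z)) else 0)"
      using inner by simp
    from has_integral_AE[OF this, THEN iffD1, OF outer]
    have "((\<lambda>y. if y \<in> {a..b} then integral {c..d} (\<lambda>z. P (y, z) * g (y, z)) else 0)
        has_integral (LINT x|lborel. Q x * g x)) UNIV" .
    then show "integral {a..b} (\<lambda>y. integral {c..d} (\<lambda>z. P (y, z) * g (y, z))) = (LINT x|lborel. Q x * g x)"
      by (simp only: has_integral_restrict_UNIV integral_unique)
  qed
  from iQ Q_out rep show thesis by (rule that)
qed

text \<open>Fubini applies because the indicator times \<open>Q\<close> is integrable on the product
  and the kernel is bounded wherever this weight is nonzero.\<close>

lemma integral_kernel_swap:
  fixes Q :: "'a \<Rightarrow> real" and k :: "real \<Rightarrow> 'a \<Rightarrow> real"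
  assumes "sigma_finite_measure M" and Q: "integrable M Q"
    and k[measurable]: "(\<lambda>(s, x). k s x) \<in> borel_measurable (lborel \<Otimes>\<^sub>M M)"
    and C: "\<And>s x. s \<in> {a..b} \<Longrightarrow> Q x \<noteq> 0 \<Longrightarrow> \<bar>k s x\<bar> \<le> C"
  shows "(LINT x|M. Q x * (LINT s|lborel. indicator {a..b} s * k s x)) =
    (LINT s|lborel. indicator {a..b} s * (LINT x|M. Q x * k s x))"
    and "integrable M (\<lambda>x. Q x * (LINT s|lborel. indicator {a..b} s * k s x))"
proof -
  interpret M: sigma_finite_measure M by fact
  interpret pair_sigma_finite lborel M ..
  note [measurable] = borel_measurable_integrable[OF Q]
  have ind: "integrable lborel (indicator {a..b} :: real \<Rightarrow> real)"
    by (rule integrable_real_indicator) (auto simp: emeasure_lborel_Icc_eq)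
  have "integrable (lborel \<Otimes>\<^sub>M M) (\<lambda>(s, x). indicator {a..b} s * Q x)"
  proof (rule Fubini_integrable)
    have "(\<lambda>s. LINT x|M. norm (case (s, x) of (s, x) \<Rightarrow> indicator {a..b} s * Q x)) = (\<lambda>s. indicator {a..b} s * (LINT x|M. \<bar>Q x\<bar>))"
      by (auto simp: abs_mult)
    moreover have "integrable lborel (\<lambda>s. indicator {a..b} s * (LINT x|M. \<bar>Q x\<bar>))"
      using ind by (rule integrable_mult_left)
    ultimately show "integrable lborel (\<lambda>s. LINT x|M. norm (case (s, x) of (s, x) \<Rightarrow> indicator {a..b} s * Q x))"
      by (simp only:)
  qed (use Q in auto)
  then have "integrable (lborel \<Otimes>\<^sub>M M) (\<lambda>p. (case p of (s, x) \<Rightarrow> indicator {a..b} s * Q x) * (case p of (s, x) \<Rightarrow> k s x))"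
    by (rule integrable_mult_bounded[where C=C]) (use C k in \<open>auto simp: indicator_def split: if_splits\<close>)
  then have int: "integrable (lborel \<Otimes>\<^sub>M M) (\<lambda>(s, x). Q x * (indicator {a..b} s * k s x))"
    by (rule Bochner_Integration.integrable_cong[THEN iffD1, rotated -1]) (auto simp: mult_ac)
  have "(LINT x|M. LINT s|lborel. Q x * (indicator {a..b} s * k s x)) =
     (LINT s|lborel. LINT x|M. Q x * (indicator {a..b} s * k s x))"
    using Fubini_integral[OF int] .
  moreover have "(LINT x|M. Q x * (indicator {a..b} s * k s x)) = indicator {a..b} s * (LINT x|M. Q x * k s x)" for s
    by (cases "s \<in> {a..b}") auto
  ultimately show "(LINT x|M. Q x * (LINT s|lborel. indicator {a..b} s * k s x)) =
    (LINT s|lborel. indicator {a..b} s * (LINT x|M. Q x * k s x))"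
    by simp
  show "integrable M (\<lambda>x. Q x * (LINT s|lborel. indicator {a..b} s * k s x))"
    using integrable_snd[OF int] by simp
qed

text \<open>The coordinate \<zeta> and the parameter \<open>x\<close> of \<open>F\<close> are kept
  abstract so that the same expansion serves both variables: with \<open>snd\<close> for derivatives
  depending on the other coordinate, and with \<open>fst\<close> after the other factor has been
  absorbed into the weight.\<close>

lemma integral_taylor:
  fixes Q \<zeta> :: "'a \<Rightarrow> real" and F :: "nat \<Rightarrow> 'a \<Rightarrow> real \<Rightarrow> real"
  assumes M: "sigma_finite_measure M" and Q: "integrable M Q"
    and z: "\<zeta> \<in> borel_measurable M" "\<And>x. Q x \<noteq> 0 \<Longrightarrow> \<zeta> x \<in> {c..d}"
    and F: "\<And>x. Q x \<noteq> 0 \<Longrightarrow> deriv_chain {c..d} (Suc N) (\<lambda>j. F j x)"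
    and Fm: "\<And>j. j \<le> N \<Longrightarrow> (\<lambda>x. F j x d) \<in> borel_measurable M"
    and Fc: "\<And>x. Q x \<noteq> 0 \<Longrightarrow> continuous_on {c..d} (F (Suc N) x)"
    and FN: "(\<lambda>(t, x). F (Suc N) x t) \<in> borel_measurable (lborel \<Otimes>\<^sub>M M)"
    and C: "\<And>j x t. j \<le> Suc N \<Longrightarrow> Q x \<noteq> 0 \<Longrightarrow> t \<in> {c..d} \<Longrightarrow> \<bar>F j x t\<bar> \<le> C"
  shows "(LINT x|M. Q x * F 0 x (\<zeta> x)) =
    (\<Sum>j\<le>N. (-1) ^ j * (LINT x|M. Q x * (F j x d * truncated_power j d (\<zeta> x)))) +
    (LINT t|lborel. indicator {c..d} t * (LINT x|M. Q x * (((-1) ^ Suc N * F (Suc N) x t) * truncated_power N t (\<zeta> x))))"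
proof -
  note [measurable] = z(1) FN
  let ?k = "\<lambda>t x. ((-1) ^ Suc N * F (Suc N) x t) * truncated_power N t (\<zeta> x)"
  have km: "(\<lambda>(t, x). ?k t x) \<in> borel_measurable (lborel \<Otimes>\<^sub>M M)"
  proof -
    have "(\<lambda>p. (-1) ^ Suc N * (case p of (t, x) \<Rightarrow> F (Suc N) x t) * truncated_power N (fst p) (\<zeta> (snd p)))
      \<in> borel_measurable (lborel \<Otimes>\<^sub>M M)" by measurable
    then show ?thesis by (simp add: case_prod_beta)
  qed
  have kb: "\<bar>?k t x\<bar> \<le> C * ((d - c) ^ N / fact N)" if "t \<in> {c..d}" "Q x \<noteq> 0" for t x
  proof -
    have "\<bar>?k t x\<bar> = \<bar>F (Suc N) x t\<bar> * truncated_power N t (\<zeta> x)"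
      by (simp add: abs_mult truncated_power_nonneg)
    also have "\<dots> \<le> C * ((d - c) ^ N / fact N)"
      using C[of "Suc N" x t] that truncated_power_le[OF z(2) that(1), of x N]
      by (intro mult_mono) (auto simp: truncated_power_nonneg)
    finally show ?thesis .
  qed
  have sw: "(LINT x|M. Q x * (LINT t|lborel. indicator {c..d} t * ?k t x)) =
    (LINT t|lborel. indicator {c..d} t * (LINT x|M. Q x * ?k t x))"
    by (rule integral_kernel_swap(1)[OF M Q km]) (rule kb)
  have ik: "integrable M (\<lambda>x. Q x * (LINT t|lborel. indicator {c..d} t * ?k t x))"
    by (rule integral_kernel_swap(2)[OF M Q km]) (rule kb)
  have ij: "integrable M (\<lambda>x. Q x * (F j x d * truncated_power j d (\<zeta> x)))" if j: "j \<le> N" for j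
  proof (rule integrable_mult_bounded[OF Q])
    show "(\<lambda>x. F j x d * truncated_power j d (\<zeta> x)) \<in> borel_measurable M"
      using Fm[OF j] by measurable
    fix x assume x: "Q x \<noteq> 0"
    have zx: "\<zeta> x \<in> {c..d}" by (rule z(2)[OF x])
    then have d: "d \<in> {c..d}" by simp
    have "\<bar>F j x d * truncated_power j d (\<zeta> x)\<bar> = \<bar>F j x d\<bar> * truncated_power j d (\<zeta> x)"
      by (simp add: abs_mult truncated_power_nonneg)
    also have "\<dots> \<le> C * ((d - c) ^ j / fact j)"
      using C[of j x d] j x d truncated_power_le[OF zx d, of j]
      by (intro mult_mono) (auto simp: truncated_power_nonneg)
    also have "\<dots> \<le> \<bar>C\<bar> * (\<Sum>j\<le>N. \<bar>(d - c) ^ j / fact j\<bar>)"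
    proof -
      have "\<bar>(d - c) ^ j / fact j\<bar> \<le> (\<Sum>j\<le>N. \<bar>(d - c) ^ j / fact j\<bar>)"
        using j by (intro member_le_sum) auto
      then have "\<bar>C * ((d - c) ^ j / fact j)\<bar> \<le> \<bar>C\<bar> * (\<Sum>j\<le>N. \<bar>(d - c) ^ j / fact j\<bar>)"
        unfolding abs_mult[of C] by (rule mult_left_mono) simp
      then show ?thesis by linarith
    qed
    finally show "\<bar>F j x d * truncated_power j d (\<zeta> x)\<bar> \<le> \<bar>C\<bar> * (\<Sum>j\<le>N. \<bar>(d - c) ^ j / fact j\<bar>)" .
  qed
  have "(LINT x|M. Q x * F 0 x (\<zeta> x)) = (LINT x|M.
      (\<Sum>j\<le>N. (-1) ^ j * (Q x * (F j x d * truncated_power j d (\<zeta> x)))) +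
      Q x * (LINT t|lborel. indicator {c..d} t * ?k t x))"
  proof (rule Bochner_Integration.integral_cong[OF refl])
    fix x
    show "Q x * F 0 x (\<zeta> x) = (\<Sum>j\<le>N. (-1) ^ j * (Q x * (F j x d * truncated_power j d (\<zeta> x)))) +
      Q x * (LINT t|lborel. indicator {c..d} t * ?k t x)"
    proof (cases "Q x = 0")
      case False
      have "Q x * (\<Sum>j\<le>N. (-1) ^ j * F j x d * truncated_power j d (\<zeta> x)) =
          (\<Sum>j\<le>N. (-1) ^ j * (Q x * (F j x d * truncated_power j d (\<zeta> x))))"
        unfolding sum_distrib_left by (rule sum.cong) (simp_all only: mult_ac)
      moreover have "F 0 x (\<zeta> x) = (\<Sum>j\<le>N. (-1) ^ j * F j x d * truncated_power j d (\<zeta> x)) +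
          (LINT t|lborel. indicator {c..d} t * ?k t x)"
        using taylor_truncated_power[OF F[OF False] Fc[OF False] z(2)[OF False]]
        by (simp only: mult.assoc)
      ultimately show ?thesis by (simp only: distrib_left)
    qed simp
  qed
  also have "\<dots> = (\<Sum>j\<le>N. (-1) ^ j * (LINT x|M. Q x * (F j x d * truncated_power j d (\<zeta> x)))) +
      (LINT x|M. Q x * (LINT t|lborel. indicator {c..d} t * ?k t x))"
  proof -
    have ij': "integrable M (\<lambda>x. (-1) ^ j * (Q x * (F j x d * truncated_power j d (\<zeta> x))))" if "j \<in> {..N}" for j
      using ij[of j] that by (intro integrable_mult_right) auto
    have "(LINT x|M. (\<Sum>j\<le>N. (-1) ^ j * (Q x * (F j x d * truncated_power j d (\<zeta> x))))) =
      (\<Sum>j\<le>N. (LINT x|M. (-1) ^ j * (Q x * (F j x d * truncated_power j d (\<zeta> x)))))"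
      using ij' by (rule Bochner_Integration.integral_sum)
    also have "\<dots> = (\<Sum>j\<le>N. (-1) ^ j * (LINT x|M. Q x * (F j x d * truncated_power j d (\<zeta> x))))"
      by (simp only: integral_mult_right_zero)
    finally have sum: "(LINT x|M. (\<Sum>j\<le>N. (-1) ^ j * (Q x * (F j x d * truncated_power j d (\<zeta> x))))) =
      (\<Sum>j\<le>N. (-1) ^ j * (LINT x|M. Q x * (F j x d * truncated_power j d (\<zeta> x))))" .
    show ?thesis
      unfolding sum[symmetric]
      by (rule Bochner_Integration.integral_add[OF _ ik], rule Bochner_Integration.integrable_sum, rule ij')
  qed
  finally show ?thesis by (simp only: sw)
qed

section \<open>The functional on the rectangle\<close>

lemma uniform_bound_on_compact:
  fixes f :: "nat \<Rightarrow> 'a::topological_space \<Rightarrow> real"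
  assumes "compact S" "\<And>j. j \<le> n \<Longrightarrow> continuous_on S (f j)"
  shows "\<exists>C. \<forall>j\<le>n. \<forall>x\<in>S. \<bar>f j x\<bar> \<le> C"
proof -
  have "\<exists>B. \<forall>x\<in>S. \<bar>f j x\<bar> \<le> B" if "j \<le> n" for j
    using compact_imp_bounded[OF compact_continuous_image[OF assms(2)[OF that] assms(1)]]
    by (auto simp: bounded_iff)
  then obtain B where B: "\<And>j x. j \<le> n \<Longrightarrow> x \<in> S \<Longrightarrow> \<bar>f j x\<bar> \<le> B j" by metis
  have "\<bar>f j x\<bar> \<le> (\<Sum>j\<le>n. \<bar>B j\<bar>)" if "j \<le> n" "x \<in> S" for j x
  proof -
    have "\<bar>f j x\<bar> \<le> \<bar>B j\<bar>" using B[OF that] by linarith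
    also have "\<dots> \<le> (\<Sum>j\<le>n. \<bar>B j\<bar>)" using that by (intro member_le_sum) auto
    finally show ?thesis .
  qed
  then show ?thesis by blast
qed

lemma deriv_chain_cong:
  assumes "deriv_chain S n D" "\<And>k x. x \<in> S \<Longrightarrow> E k x = D k x"
  shows "deriv_chain S n E"
  unfolding deriv_chain_def
proof (intro allI impI ballI)
  fix k x assume k: "k < n" and x: "x \<in> S"
  have "(D k has_real_derivative E (Suc k) x) (at x within S)"
    using deriv_chainD[OF assms(1) k x] assms(2)[OF x] by simp
  then show "(E k has_real_derivative E (Suc k) x) (at x within S)"
    unfolding has_real_derivative_iff_has_vector_derivative
    by (rule has_vector_derivative_transform[OF x assms(2), rotated])
qed

lemma fst_snd_borel_measurable [measurable]:
  "fst \<in> borel_measurable (borel :: (real \<times> real) measure)"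
  "snd \<in> borel_measurable (borel :: (real \<times> real) measure)"
  by (auto intro!: borel_measurable_continuous_onI continuous_intros)

text \<open>The \<open>y\<close>-expansion under a fixed \<open>z\<close>-weight. The premise
  \<open>zero\<close> removes all endpoint terms, so only the remainder is left.\<close>

lemma integral_prod_taylor:
  fixes Q :: "real \<times> real \<Rightarrow> real"
  assumes Q: "integrable lborel Q" and out: "\<And>x. x \<notin> {a..b} \<times> {c..d} \<Longrightarrow> Q x = 0"
    and g: "deriv_chain {a..b} (Suc M) g" "continuous_on {a..b} (g (Suc M))"
    and w: "w \<in> borel_measurable borel" "\<And>z. z \<in> {c..d} \<Longrightarrow> \<bar>w z\<bar> \<le> B"
    and zero: "\<And>i. i \<le> M \<Longrightarrow> (LINT x|lborel. Q x * (truncated_power i b (fst x) * w (snd x))) = 0"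
  shows "(LINT x|lborel. Q x * (g 0 (fst x) * w (snd x))) =
    (LINT s|lborel. indicator {a..b} s * ((-1) ^ Suc M * g (Suc M) s *
      (LINT x|lborel. Q x * (truncated_power M s (fst x) * w (snd x)))))"
proof -
  \<comment> \<open>Clamping makes the top derivative continuous, hence Borel, on the whole line
    without changing values on {a..b}; \<open>w\<close> goes into the weight
    \<open>Q'\<close>.\<close>
  define G where "G = (\<lambda>k t. g k (clamp a b t))"
  define Q' where "Q' = (\<lambda>x. Q x * w (snd x))"
  have G_eq: "G k t = g k t" if "t \<in> {a..b}" for k t using that by (simp add: G_def)
  have in_R: "fst x \<in> {a..b}" "snd x \<in> {c..d}" if "Q x \<noteq> 0" for x
    using out[of x] that by (cases x; auto)+
  note [measurable] = w(1)
  have "(\<lambda>x :: real \<times> real. w (snd x)) \<in> borel_measurable lborel" by measurable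
  then have iQ': "integrable lborel Q'"
    unfolding Q'_def by (rule integrable_mult_bounded[OF Q]) (use w(2) in_R in blast)
  have chain: "deriv_chain {a..b} (Suc M) G"
    by (rule deriv_chain_cong[OF g(1) G_eq])
  have "continuous_on UNIV (G (Suc M))"
    unfolding G_def by (rule clamp_continuous_on) (use g(2) in simp)
  then have Gm[measurable]: "G (Suc M) \<in> borel_measurable borel"
    and Gc: "continuous_on {a..b} (G (Suc M))"
    by (auto intro: borel_measurable_continuous_onI continuous_on_subset)
  obtain C where C: "\<And>j x. j \<le> Suc M \<Longrightarrow> x \<in> {a..b} \<Longrightarrow> \<bar>G j x\<bar> \<le> C"
    using uniform_bound_on_compact[OF compact_Icc, of "Suc M" a b G] deriv_chain_continuous[OF chain Gc] by metis
  have taylor: "(LINT x|lborel. Q' x * G 0 (fst x)) =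
    (\<Sum>j\<le>M. (-1) ^ j * (LINT x|lborel. Q' x * (G j b * truncated_power j b (fst x)))) +
    (LINT t|lborel. indicator {a..b} t *
      (LINT x|lborel. Q' x * (((-1) ^ Suc M * G (Suc M) t) * truncated_power M t (fst x))))"
  proof (rule integral_taylor[where F="\<lambda>j x t. G j t" and C=C])
    show "sigma_finite_measure lborel" by (rule sigma_finite_lborel)
    show "(\<lambda>(t, x::real \<times> real). G (Suc M) t) \<in> borel_measurable (lborel \<Otimes>\<^sub>M lborel)"
      by measurable
  qed (use iQ' chain Gc C in_R in \<open>auto simp: Q'_def\<close>)
  have pull: "(LINT x|lborel. Q' x * (r * truncated_power j s (fst x))) =
     r * (LINT x|lborel. Q x * (truncated_power j s (fst x) * w (snd x)))" for r j s
    unfolding Q'_def integral_mult_right_zero[symmetric]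
    by (rule Bochner_Integration.integral_cong) (simp_all only: mult_ac)
  have lhs: "(LINT x|lborel. Q' x * G 0 (fst x)) = (LINT x|lborel. Q x * (g 0 (fst x) * w (snd x)))"
  proof (rule Bochner_Integration.integral_cong[OF refl])
    fix x show "Q' x * G 0 (fst x) = Q x * (g 0 (fst x) * w (snd x))"
      using in_R(1)[of x] G_eq[of "fst x" 0] by (cases "Q x = 0") (simp_all add: Q'_def)
  qed
  have ind: "indicator {a..b} t * ((-1) ^ Suc M * G (Suc M) t * L) = indicator {a..b} t * ((-1) ^ Suc M * g (Suc M) t * L)"
    for t L :: real
    using G_eq[of t "Suc M"] by (cases "t \<in> {a..b}") auto
  have "(\<Sum>j\<le>M. (-1) ^ j * (LINT x|lborel. Q' x * (G j b * truncated_power j b (fst x)))) = 0"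
    by (rule sum.neutral, rule ballI) (simp only: pull zero atMost_iff mult_zero_right)
  then show ?thesis
    using taylor by (simp only: pull lhs ind add_0_left)
qed

text \<open>The expansion in \<open>z\<close> comes first, with coefficients that are still
  functions of \<open>y\<close>; each of them is then expanded in \<open>y\<close>.\<close>

lemma integral_nonneg_of_conditions:
  fixes Q :: "real \<times> real \<Rightarrow> real"
  assumes Q: "integrable lborel Q" and out: "\<And>x. x \<notin> {a..b} \<times> {c..d} \<Longrightarrow> Q x = 0"
    and ab: "a < b" and cd: "c < d"
    and f: "has_continuous_pderivs (Suc M) (Suc N) {a..b} {c..d} f"
    and sign: "\<And>y z. y \<in> {a..b} \<Longrightarrow> z \<in> {c..d} \<Longrightarrow>
      0 \<le> (-1) ^ (Suc M + Suc N) * mixed_pderiv {a..b} {c..d} (Suc M) (Suc N) f (y, z)"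
    and h1: "\<And>i j. i \<le> M \<Longrightarrow> j \<le> N \<Longrightarrow>
      (LINT x|lborel. Q x * (truncated_power i b (fst x) * truncated_power j d (snd x))) = 0"
    and h2: "\<And>s j. s \<in> {a..b} \<Longrightarrow> j \<le> N \<Longrightarrow>
      (LINT x|lborel. Q x * (truncated_power M s (fst x) * truncated_power j d (snd x))) = 0"
    and h3: "\<And>i t. i \<le> M \<Longrightarrow> t \<in> {c..d} \<Longrightarrow>
      (LINT x|lborel. Q x * (truncated_power i b (fst x) * truncated_power N t (snd x))) = 0"
    and h4: "\<And>s t. s \<in> {a..b} \<Longrightarrow> t \<in> {c..d} \<Longrightarrow>
      0 \<le> (LINT x|lborel. Q x * (truncated_power M s (fst x) * truncated_power N t (snd x)))"
  shows "0 \<le> (LINT x|lborel. Q x * f x)"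
proof -
  let ?m = "mixed_pderiv {a..b} {c..d}"
  let ?cl = "clamp (a, c) (b, d)"
  define F where "F = (\<lambda>j (x :: real \<times> real) t. ?m 0 j f (?cl (fst x, t)))"
  have cl: "?cl (y, z) = (y, z)" if "y \<in> {a..b}" "z \<in> {c..d}" for y z
    using that by (intro clamp_cancel_cbox) (simp add: cbox_Pair_eq)
  have in_R: "fst x \<in> {a..b}" "snd x \<in> {c..d}" if "Q x \<noteq> 0" for x
    using out[of x] that by (cases x; auto)+
  have Fe: "F j x t = ?m 0 j f (fst x, t)" if "Q x \<noteq> 0" "t \<in> {c..d}" for j x t
    using cl[OF in_R(1)[OF that(1)] that(2)] by (simp add: F_def)
  have mc: "continuous_on UNIV (\<lambda>p. ?m 0 j f (?cl p))" if "j \<le> Suc N" for j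
    by (rule clamp_continuous_on) (use continuous_on_mixed_pderiv[OF f _ that, of 0] in \<open>simp add: cbox_Pair_eq\<close>)
  have mm: "(\<lambda>p. ?m 0 j f (?cl p)) \<in> borel_measurable borel" if "j \<le> Suc N" for j
    by (rule borel_measurable_continuous_onI[OF mc[OF that]])
  obtain C where C: "\<And>j p. j \<le> Suc N \<Longrightarrow> p \<in> {a..b} \<times> {c..d} \<Longrightarrow> \<bar>?m 0 j f p\<bar> \<le> C"
    using uniform_bound_on_compact[of "{a..b} \<times> {c..d}" "Suc N" "\<lambda>j. ?m 0 j f"]
      continuous_on_mixed_pderiv[OF f] by (metis compact_Icc compact_Times le0)
  have chain_y: "deriv_chain {a..b} (Suc M) (\<lambda>i u. ?m i j f (u, t))"
    and cont_y: "continuous_on {a..b} (\<lambda>u. ?m (Suc M) j f (u, t))" if "j \<le> Suc N" "t \<in> {c..d}" for j t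
  proof -
    show "deriv_chain {a..b} (Suc M) (\<lambda>i u. ?m i j f (u, t))" by (rule mixed_pderiv_y[OF f that])
    show "continuous_on {a..b} (\<lambda>u. ?m (Suc M) j f (u, t))"
      by (rule continuous_on_compose2[OF continuous_on_mixed_pderiv[OF f order_refl that(1)]])
        (use that(2) in \<open>auto intro!: continuous_intros\<close>)
  qed
  have F_prod: "(LINT x|lborel. Q x * (F j x t * w (snd x))) = (LINT x|lborel. Q x * (?m 0 j f (fst x, t) * w (snd x)))"
    if "t \<in> {c..d}" for j t and w :: "real \<Rightarrow> real"
  proof (rule Bochner_Integration.integral_cong[OF refl])
    fix x show "Q x * (F j x t * w (snd x)) = Q x * (?m 0 j f (fst x, t) * w (snd x))"
      using Fe[of x t j] that by (cases "Q x = 0") simp_all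
  qed
  have tp: "truncated_power j t \<in> borel_measurable borel" for j t by measurable
  have tpb: "\<bar>truncated_power j t z\<bar> \<le> (d - c) ^ j / fact j" if "t \<in> {c..d}" "z \<in> {c..d}" for j t z
    using truncated_power_le[OF that(2,1)] by (simp add: truncated_power_nonneg)
  have d: "d \<in> {c..d}" using cd by simp
  \<comment> \<open>In the endpoint terms of the \<open>z\<close>-expansion, \<open>h1\<close>
    removes the endpoint terms in \<open>y\<close> and \<open>h2\<close> the remainder.\<close>
  have low: "(LINT x|lborel. Q x * (F j x d * truncated_power j d (snd x))) = 0" if j: "j \<le> N" for j
  proof -
    have j': "j \<le> Suc N" using j by simp
    have "(LINT x|lborel. Q x * (F j x d * truncated_power j d (snd x))) =
      (LINT s|lborel. indicator {a..b} s * ((-1) ^ Suc M * ?m (Suc M) j f (s, d) *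
      (LINT x|lborel. Q x * (truncated_power M s (fst x) * truncated_power j d (snd x)))))"
      unfolding F_prod[OF d]
      by (rule integral_prod_taylor[OF Q out chain_y[OF j' d] cont_y[OF j' d] tp tpb[OF d]])
        (use h1 j in auto)
    also have "\<dots> = (LINT s|(lborel :: real measure). 0)"
    proof (rule Bochner_Integration.integral_cong[OF refl])
      fix s show "indicator {a..b} s * ((-1) ^ Suc M * ?m (Suc M) j f (s, d) *
          (LINT x|lborel. Q x * (truncated_power M s (fst x) * truncated_power j d (snd x)))) = 0"
        using h2[of s j] j by (cases "s \<in> {a..b}") auto
    qed
    finally show ?thesis by simp
  qed
  \<comment> \<open>In the \<open>z\<close>-remainder, \<open>h3\<close> removes the endpoint terms
    in \<open>y\<close>. What is left is the signed top derivative times the quantity in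
    \<open>h4\<close>.\<close>
  have top: "0 \<le> (LINT x|lborel. Q x * (((-1) ^ Suc N * F (Suc N) x t) * truncated_power N t (snd x)))"
    if t: "t \<in> {c..d}" for t
  proof -
    have "(LINT x|lborel. Q x * (((-1) ^ Suc N * F (Suc N) x t) * truncated_power N t (snd x))) =
       (-1) ^ Suc N * (LINT x|lborel. Q x * (F (Suc N) x t * truncated_power N t (snd x)))"
      unfolding integral_mult_right_zero[symmetric]
      by (rule Bochner_Integration.integral_cong) (simp_all only: mult_ac)
    also have "(LINT x|lborel. Q x * (F (Suc N) x t * truncated_power N t (snd x))) =
      (LINT s|lborel. indicator {a..b} s * ((-1) ^ Suc M * ?m (Suc M) (Suc N) f (s, t) *
      (LINT x|lborel. Q x * (truncated_power M s (fst x) * truncated_power N t (snd x)))))"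
      unfolding F_prod[OF t]
      by (rule integral_prod_taylor[OF Q out chain_y[OF order_refl t] cont_y[OF order_refl t] tp tpb[OF t]])
        (use h3 t in auto)
    also have "(-1) ^ Suc N * \<dots> =
      (LINT s|lborel. indicator {a..b} s * (((-1) ^ (Suc M + Suc N) * ?m (Suc M) (Suc N) f (s, t)) *
      (LINT x|lborel. Q x * (truncated_power M s (fst x) * truncated_power N t (snd x)))))"
      unfolding integral_mult_right_zero[symmetric] power_add
      by (rule Bochner_Integration.integral_cong) (simp_all only: mult_ac)
    also have "0 \<le> \<dots>"
    proof (rule Bochner_Integration.integral_nonneg)
      fix s show "0 \<le> indicator {a..b} s * (((-1) ^ (Suc M + Suc N) * ?m (Suc M) (Suc N) f (s, t)) *
          (LINT x|lborel. Q x * (truncated_power M s (fst x) * truncated_power N t (snd x))))"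
        using mult_nonneg_nonneg[OF sign[of s t] h4[of s t]] t by (cases "s \<in> {a..b}") auto
    qed
    finally show ?thesis .
  qed
  have "(LINT x|lborel. Q x * f x) = (LINT x|lborel. Q x * F 0 x (snd x))"
  proof (rule Bochner_Integration.integral_cong[OF refl])
    fix x show "Q x * f x = Q x * F 0 x (snd x)"
      using Fe[of x "snd x" 0] in_R(2)[of x] by (cases "Q x = 0") (simp_all add: mixed_pderiv_00)
  qed
  also have "\<dots> = (\<Sum>j\<le>N. (-1) ^ j * (LINT x|lborel. Q x * (F j x d * truncated_power j d (snd x)))) +
    (LINT t|lborel. indicator {c..d} t *
      (LINT x|lborel. Q x * (((-1) ^ Suc N * F (Suc N) x t) * truncated_power N t (snd x))))"
  proof (rule integral_taylor[where C=C])
    show "sigma_finite_measure lborel" by (rule sigma_finite_lborel)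
    show "integrable lborel Q" by (rule Q)
    show "snd \<in> borel_measurable (lborel :: (real \<times> real) measure)" by simp
    fix x assume x: "Q x \<noteq> 0"
    show "snd x \<in> {c..d}" by (rule in_R(2)[OF x])
    have "deriv_chain {c..d} (Suc N) (\<lambda>j v. ?m 0 j f (fst x, v))"
      by (rule mixed_pderiv_z[OF f in_R(1)[OF x]])
    then show "deriv_chain {c..d} (Suc N) (\<lambda>j. F j x)"
      by (rule deriv_chain_cong) (rule Fe[OF x])
    show "continuous_on {c..d} (F (Suc N) x)"
      unfolding F_def by (rule continuous_on_compose2[OF mc]) (auto intro!: continuous_intros)
    fix j t assume "j \<le> Suc N" "t \<in> {c..d}"
    then show "\<bar>F j x t\<bar> \<le> C"
      using C[of j "(fst x, t)"] in_R[OF x] Fe[OF x, of t j] by auto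
  next
    fix j assume "j \<le> N"
    then have [measurable]: "(\<lambda>p. ?m 0 j f (?cl p)) \<in> borel_measurable (borel \<Otimes>\<^sub>M borel)"
      using mm[of j] by (simp add: borel_prod)
    have "(\<lambda>x. F j x d) \<in> borel_measurable (borel \<Otimes>\<^sub>M borel)"
      unfolding F_def by measurable
    then show "(\<lambda>x. F j x d) \<in> borel_measurable lborel"
      by (simp add: borel_prod)
  next
    have [measurable]: "(\<lambda>p. ?m 0 (Suc N) f (?cl p)) \<in> borel_measurable (borel \<Otimes>\<^sub>M borel)"
      using mm[of "Suc N"] by (simp add: borel_prod)
    have "(\<lambda>p. F (Suc N) (snd p) (fst p)) \<in> borel_measurable (borel \<Otimes>\<^sub>M (borel \<Otimes>\<^sub>M borel))"
      unfolding F_def by measurable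
    moreover have "borel_measurable (lborel \<Otimes>\<^sub>M (lborel :: (real \<times> real) measure)) =
        (borel_measurable (borel \<Otimes>\<^sub>M (borel \<Otimes>\<^sub>M borel)) :: (real \<times> real \<times> real \<Rightarrow> real) set)"
    proof (intro measurable_cong_sets sets_pair_measure_cong)
      show "sets (lborel :: (real \<times> real) measure) = sets (borel \<Otimes>\<^sub>M borel)"
        by (simp only: sets_lborel borel_prod)
    qed simp_all
    ultimately show "(\<lambda>(t, x). F (Suc N) x t) \<in> borel_measurable (lborel \<Otimes>\<^sub>M lborel)"
      by (simp only: case_prod_unfold)
  qed
  also have "\<dots> = (LINT t|lborel. indicator {c..d} t *
      (LINT x|lborel. Q x * (((-1) ^ Suc N * F (Suc N) x t) * truncated_power N t (snd x))))"
    using low by simp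
  also have "0 \<le> \<dots>"
  proof (rule Bochner_Integration.integral_nonneg)
    fix t show "0 \<le> indicator {c..d} t *
      (LINT x|lborel. Q x * (((-1) ^ Suc N * F (Suc N) x t) * truncated_power N t (snd x)))"
      using top[of t] by (cases "t \<in> {c..d}") auto
  qed
  finally show ?thesis .
qed

section \<open>From smooth products to kernels\<close>

text \<open>Both factors are approximated with the same index, so a single passage to the limit
  suffices; the product of the two uniform bounds times the absolute value of \<open>Q\<close>
  dominates.\<close>

lemma cone_limit_integral_nonneg:
  fixes Q :: "real \<times> real \<Rightarrow> real"
  assumes Q: "integrable lborel Q" and out: "\<And>x. x \<notin> {a..b} \<times> {c..d} \<Longrightarrow> Q x = 0"
    and H: "\<And>g h. deriv_chain UNIV m g \<Longrightarrow> continuous_on UNIV (g m) \<Longrightarrow>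
      (\<And>y. y \<in> {a..b} \<Longrightarrow> 0 \<le> (-1) ^ m * g m y) \<Longrightarrow>
      deriv_chain UNIV n h \<Longrightarrow> continuous_on UNIV (h n) \<Longrightarrow>
      (\<And>z. z \<in> {c..d} \<Longrightarrow> 0 \<le> (-1) ^ n * h n z) \<Longrightarrow>
      0 \<le> (LINT x|lborel. Q x * (g 0 (fst x) * h 0 (snd x)))"
    and u: "cone_limit m {a..b} u" and v: "cone_limit n {c..d} v"
    and [measurable]: "u \<in> borel_measurable borel" "v \<in> borel_measurable borel"
  shows "0 \<le> (LINT x|lborel. Q x * (u (fst x) * v (snd x)))"
proof -
  obtain G C where G: "\<And>k. deriv_chain UNIV m (G k)" "\<And>k. continuous_on UNIV (G k m)"
    "\<And>k y. y \<in> {a..b} \<Longrightarrow> 0 \<le> (-1) ^ m * G k m y"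
    "\<And>k y. y \<in> {a..b} \<Longrightarrow> \<bar>G k 0 y\<bar> \<le> C" "\<And>y. y \<in> {a..b} \<Longrightarrow> (\<lambda>k. G k 0 y) \<longlonglongrightarrow> u y"
    using u unfolding cone_limit_def by metis
  obtain K D where K: "\<And>k. deriv_chain UNIV n (K k)" "\<And>k. continuous_on UNIV (K k n)"
    "\<And>k y. y \<in> {c..d} \<Longrightarrow> 0 \<le> (-1) ^ n * K k n y"
    "\<And>k y. y \<in> {c..d} \<Longrightarrow> \<bar>K k 0 y\<bar> \<le> D" "\<And>y. y \<in> {c..d} \<Longrightarrow> (\<lambda>k. K k 0 y) \<longlonglongrightarrow> v y"
    using v unfolding cone_limit_def by metis
  have in_R: "fst x \<in> {a..b}" "snd x \<in> {c..d}" if "Q x \<noteq> 0" for x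
    using out[of x] that by (cases x; auto)+
  have [measurable]: "G k 0 \<in> borel_measurable borel" "K k 0 \<in> borel_measurable borel" for k
    using deriv_chain_continuous[OF G(1) G(2), of 0 k] deriv_chain_continuous[OF K(1) K(2), of 0 k]
    by (auto intro: borel_measurable_continuous_onI)
  note [measurable] = borel_measurable_integrable[OF Q]
  have "(\<lambda>k. LINT x|lborel. Q x * (G k 0 (fst x) * K k 0 (snd x))) \<longlonglongrightarrow> (LINT x|lborel. Q x * (u (fst x) * v (snd x)))"
  proof (rule integral_dominated_convergence)
    show "integrable lborel (\<lambda>x. \<bar>Q x\<bar> * (C * D))" using Q by simp
    show "AE x in lborel. (\<lambda>k. Q x * (G k 0 (fst x) * K k 0 (snd x))) \<longlonglongrightarrow> Q x * (u (fst x) * v (snd x))"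
    proof (rule AE_I2)
      fix x show "(\<lambda>k. Q x * (G k 0 (fst x) * K k 0 (snd x))) \<longlonglongrightarrow> Q x * (u (fst x) * v (snd x))"
        using in_R[of x] by (cases "Q x = 0") (auto intro!: tendsto_intros G(5) K(5))
    qed
    fix k
    show "AE x in lborel. norm (Q x * (G k 0 (fst x) * K k 0 (snd x))) \<le> \<bar>Q x\<bar> * (C * D)"
    proof (rule AE_I2)
      fix x show "norm (Q x * (G k 0 (fst x) * K k 0 (snd x))) \<le> \<bar>Q x\<bar> * (C * D)"
      proof (cases "Q x = 0")
        case False
        have "\<bar>G k 0 (fst x)\<bar> * \<bar>K k 0 (snd x)\<bar> \<le> C * D"
          using G(4)[OF in_R(1)[OF False], of k] K(4)[OF in_R(2)[OF False], of k]
          by (intro mult_mono) auto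
        then show ?thesis by (simp add: abs_mult mult_left_mono)
      qed simp
    qed
  qed measurable
  then show ?thesis
    by (rule LIMSEQ_le_const) (use H[OF G(1-3) K(1-3)] in blast)
qed

text \<open>Moves the variable upper limits into the kernels, so that all four conditions become
  integrals over one fixed rectangle.\<close>

lemma integral_truncated_power:
  fixes P :: "real \<times> real \<Rightarrow> real"
  assumes "s \<in> {a..b}" "t \<in> {c..d}"
  shows "integral {a..s} (\<lambda>y. integral {c..t} (\<lambda>z. P (y, z) * ((s - y) ^ i / fact i) * ((t - z) ^ j / fact j))) =
    integral {a..b} (\<lambda>y. integral {c..d} (\<lambda>z. P (y, z) * (truncated_power i s y * truncated_power j t z)))"
proof -
  have restrict: "integral {p..r} \<phi> = integral {p..q} (\<lambda>x. if x \<le> r then \<phi> x else 0)"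
    if "r \<in> {p..q}" for p q r :: real and \<phi> :: "real \<Rightarrow> real"
  proof -
    have "integral {p..q} (\<lambda>x. if x \<in> {..r} then \<phi> x else 0) = integral ({..r} \<inter> {p..q}) \<phi>"
      by (rule integral_restrict_Int)
    moreover have "{..r} \<inter> {p..q} = {p..r}" using that by auto
    ultimately show ?thesis by (simp only: atMost_iff)
  qed
  have "integral {c..t} (\<lambda>z. P (y, z) * ((s - y) ^ i / fact i) * ((t - z) ^ j / fact j)) =
      integral {c..d} (\<lambda>z. P (y, z) * (truncated_power i s y * truncated_power j t z))" if "y \<le> s" for y
    unfolding restrict[OF assms(2)] using that
    by (intro integral_cong) (auto simp: truncated_power_def mult_ac)
  moreover have "integral {c..d} (\<lambda>z. P (y, z) * (truncated_power i s y * truncated_power j t z)) = 0" if "\<not> y \<le> s" for y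
    using that by (simp add: truncated_power_def)
  ultimately show ?thesis
    unfolding restrict[OF assms(1)] by (intro integral_cong) auto
qed

theorem theorem4p5:
  fixes a b c d :: real and M N :: nat and P :: "real \<times> real \<Rightarrow> real"
  assumes "a < b" and "c < d"
    and "P absolutely_integrable_on ({a..b} \<times> {c..d})"
  shows "(\<forall>f :: real \<times> real \<Rightarrow> real.
        nabla_convex (M + 1) (N + 1) {a..b} {c..d} f \<longrightarrow>
        has_continuous_pderivs (M + 1) (N + 1) {a..b} {c..d} f \<longrightarrow>
        integral {a..b} (\<lambda>y. integral {c..d} (\<lambda>z. P (y, z) * f (y, z))) \<ge> 0)
    \<longleftrightarrow>
      (\<forall>i\<in>{0..M}. \<forall>j\<in>{0..N}.
        integral {a..b} (\<lambda>y. integral {c..d} (\<lambda>z.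
          P (y, z) * ((b - y) ^ i / fact i) * ((d - z) ^ j / fact j))) = 0) \<and>
      (\<forall>j\<in>{0..N}. \<forall>s\<in>{a..b}.
        integral {a..s} (\<lambda>y. integral {c..d} (\<lambda>z.
          P (y, z) * ((s - y) ^ M / fact M) * ((d - z) ^ j / fact j))) = 0) \<and>
      (\<forall>i\<in>{0..M}. \<forall>t\<in>{c..d}.
        integral {a..b} (\<lambda>y. integral {c..t} (\<lambda>z.
          P (y, z) * ((b - y) ^ i / fact i) * ((t - z) ^ N / fact N))) = 0) \<and>
      (\<forall>s\<in>{a..b}. \<forall>t\<in>{c..d}.
        integral {a..s} (\<lambda>y. integral {c..t} (\<lambda>z.
          P (y, z) * ((s - y) ^ M / fact M) * ((t - z) ^ N / fact N))) \<ge> 0)"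
proof -
  let ?R = "{a..b} \<times> {c..d}"
  note ab = assms(1) and cd = assms(2)
  have b: "b \<in> {a..b}" and d: "d \<in> {c..d}" using ab cd by auto
  obtain Q where Q: "integrable lborel Q" and out: "\<And>x. x \<notin> ?R \<Longrightarrow> Q x = 0"
    and rep0: "\<forall>g\<in>borel_measurable borel. \<forall>C. (\<forall>x\<in>?R. \<bar>g x\<bar> \<le> C) \<longrightarrow>
      integral {a..b} (\<lambda>y. integral {c..d} (\<lambda>z. P (y, z) * g (y, z))) = (LINT x|lborel. Q x * g x)"
    by (rule borel_representation[OF assms(3)]) blast
  have rep: "integral {a..b} (\<lambda>y. integral {c..d} (\<lambda>z. P (y, z) * g (y, z))) = (LINT x|lborel. Q x * g x)"
    if "g \<in> borel_measurable borel" "\<And>x. x \<in> ?R \<Longrightarrow> \<bar>g x\<bar> \<le> C" for g C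
    using rep0 that by blast
  define T where "T = (\<lambda>i j s t. LINT x|lborel. Q x * (truncated_power i s (fst x) * truncated_power j t (snd x)))"
  have T: "integral {a..s} (\<lambda>y. integral {c..t} (\<lambda>z. P (y, z) * ((s - y) ^ i / fact i) * ((t - z) ^ j / fact j))) = T i j s t"
    if s: "s \<in> {a..b}" and t: "t \<in> {c..d}" for s t i j
  proof -
    have "integral {a..b} (\<lambda>y. integral {c..d} (\<lambda>z. P (y, z) * (\<lambda>x. truncated_power i s (fst x) * truncated_power j t (snd x)) (y, z)))
      = T i j s t"
      unfolding T_def
    proof (rule rep)
      fix x assume x: "x \<in> ?R"
      have "truncated_power i s (fst x) * truncated_power j t (snd x) \<le> ((b - a) ^ i / fact i) * ((d - c) ^ j / fact j)"
        using truncated_power_le[of "fst x" a b s i] truncated_power_le[of "snd x" c d t j] s t x ab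
        by (intro mult_mono) (auto simp: truncated_power_nonneg)
      then show "\<bar>truncated_power i s (fst x) * truncated_power j t (snd x)\<bar> \<le> ((b - a) ^ i / fact i) * ((d - c) ^ j / fact j)"
        by (simp add: abs_mult truncated_power_nonneg)
    qed measurable
    then show ?thesis by (simp only: integral_truncated_power[OF s t] fst_conv snd_conv)
  qed
  \<comment> \<open>Admissible functions are continuous only on the rectangle, so a clamped
    extension supplies the Borel function that \<open>rep\<close> needs.\<close>
  have \<Lambda>: "integral {a..b} (\<lambda>y. integral {c..d} (\<lambda>z. P (y, z) * f (y, z))) = (LINT x|lborel. Q x * f x)"
    if f: "continuous_on ?R f" for f :: "real \<times> real \<Rightarrow> real"
  proof -
    let ?f = "\<lambda>x. f (clamp (a, c) (b, d) x)"
    have eq: "?f x = f x" if "x \<in> ?R" for x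
      using that by (intro arg_cong[where f=f] clamp_cancel_cbox) (auto simp: cbox_Pair_eq)
    have "continuous_on UNIV ?f" by (rule clamp_continuous_on) (use f in \<open>simp add: cbox_Pair_eq\<close>)
    then have m: "?f \<in> borel_measurable borel" by (rule borel_measurable_continuous_onI)
    have "\<exists>C. \<forall>j\<le>0::nat. \<forall>x\<in>?R. \<bar>f x\<bar> \<le> C"
      by (rule uniform_bound_on_compact) (use f in \<open>auto simp: compact_Times\<close>)
    then obtain C where "\<forall>x\<in>?R. \<bar>f x\<bar> \<le> C" by blast
    then have C: "\<bar>?f x\<bar> \<le> C" if "x \<in> ?R" for x
      unfolding eq[OF that] using that by (rule bspec)
    have "integral {a..b} (\<lambda>y. integral {c..d} (\<lambda>z. P (y, z) * f (y, z))) =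
        integral {a..b} (\<lambda>y. integral {c..d} (\<lambda>z. P (y, z) * ?f (y, z)))"
      by (intro integral_cong) (use eq in auto)
    also have "\<dots> = (LINT x|lborel. Q x * ?f x)" by (rule rep[OF m C])
    also have "\<dots> = (LINT x|lborel. Q x * f x)"
    proof (rule Bochner_Integration.integral_cong[OF refl])
      fix x show "Q x * ?f x = Q x * f x"
        using eq[of x] out[of x] by (cases "x \<in> ?R") auto
    qed
    finally show ?thesis .
  qed
  have conditions: "(\<forall>i\<in>{0..M}. \<forall>j\<in>{0..N}. T i j b d = 0) \<and> (\<forall>j\<in>{0..N}. \<forall>s\<in>{a..b}. T M j s d = 0) \<and>
      (\<forall>i\<in>{0..M}. \<forall>t\<in>{c..d}. T i N b t = 0) \<and> (\<forall>s\<in>{a..b}. \<forall>t\<in>{c..d}. 0 \<le> T M N s t)"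
    if H: "\<And>f. nabla_convex (M + 1) (N + 1) {a..b} {c..d} f \<Longrightarrow>
      has_continuous_pderivs (M + 1) (N + 1) {a..b} {c..d} f \<Longrightarrow>
      0 \<le> integral {a..b} (\<lambda>y. integral {c..d} (\<lambda>z. P (y, z) * f (y, z)))"
  proof -
    have prod: "0 \<le> (LINT x|lborel. Q x * (g 0 (fst x) * h 0 (snd x)))"
      if g: "deriv_chain UNIV (Suc M) g" "continuous_on UNIV (g (Suc M))"
        "\<And>y. y \<in> {a..b} \<Longrightarrow> 0 \<le> (-1) ^ Suc M * g (Suc M) y"
      and h: "deriv_chain UNIV (Suc N) h" "continuous_on UNIV (h (Suc N))"
        "\<And>z. z \<in> {c..d} \<Longrightarrow> 0 \<le> (-1) ^ Suc N * h (Suc N) z" for g h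
    proof -
      let ?f = "\<lambda>(y, z). g 0 y * h 0 z"
      note g' = deriv_chain_subset[OF g(1), of "{a..b}", simplified]
      note h' = deriv_chain_subset[OF h(1), of "{c..d}", simplified]
      have cont: "has_continuous_pderivs (Suc M) (Suc N) {a..b} {c..d} ?f"
        by (rule has_continuous_pderivs_prod[OF ab cd g' h'])
          (auto intro: continuous_on_subset[OF g(2)] continuous_on_subset[OF h(2)])
      have "0 \<le> integral {a..b} (\<lambda>y. integral {c..d} (\<lambda>z. P (y, z) * ?f (y, z)))"
        by (rule H) (use nabla_convex_prod[OF g' h' g(3) h(3)] cont in simp_all)
      also have "\<dots> = (LINT x|lborel. Q x * ?f x)"
        by (rule \<Lambda>) (use continuous_on_mixed_pderiv[OF cont, of 0 0] in \<open>simp add: mixed_pderiv_00\<close>)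
      finally show ?thesis by (simp add: case_prod_beta)
    qed
    have tp: "(\<lambda>y. \<epsilon> * truncated_power i s y) \<in> borel_measurable borel" for \<epsilon> i s by measurable
    \<comment> \<open>The factors \<epsilon> and \<delta> let one statement cover all four
      conditions: a remainder kernel enters with factor 1, a power with any real factor.\<close>
    have nonneg: "0 \<le> \<epsilon> * \<delta> * T i j s t"
      if "cone_limit (Suc M) {a..b} (\<lambda>y. \<epsilon> * truncated_power i s y)"
        "cone_limit (Suc N) {c..d} (\<lambda>z. \<delta> * truncated_power j t z)" for \<epsilon> \<delta> i j s t
    proof -
      have "0 \<le> (LINT x|lborel. Q x * (\<epsilon> * truncated_power i s (fst x) * (\<delta> * truncated_power j t (snd x))))"
      proof (rule cone_limit_integral_nonneg[OF Q,
          where u="\<lambda>y. \<epsilon> * truncated_power i s y" and v="\<lambda>z. \<delta> * truncated_power j t z"])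
        show "Q x = 0" if "x \<notin> ?R" for x by (rule out[OF that])
        show "cone_limit (Suc M) {a..b} (\<lambda>y. \<epsilon> * truncated_power i s y)"
          "cone_limit (Suc N) {c..d} (\<lambda>z. \<delta> * truncated_power j t z)"
          by (fact that)+
      qed (fact prod | rule tp)+
      also have "\<dots> = \<epsilon> * \<delta> * T i j s t"
        unfolding T_def integral_mult_right_zero[symmetric]
        by (rule Bochner_Integration.integral_cong) (simp_all only: mult_ac)
      finally show ?thesis .
    qed
    have trunc: "cone_limit (Suc m) {p..q} (\<lambda>y. 1 * truncated_power m s y)" if "s \<in> {p..q}" for m p q s
      using cone_limit_truncated_power[OF that] by simp
    \<comment> \<open>The free factor, taken as 1 and -1, turns the inequality into an equality as
      soon as one power is present.\<close>
    have zero: "x = 0" if "\<And>\<epsilon>. 0 \<le> \<epsilon> * x" for x :: real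
      using that[of 1] that[of "-1"] by simp
    have "T i j b d = 0" if "i \<le> M" "j \<le> N" for i j
      using nonneg[OF cone_limit_monomial[OF that(1)] cone_limit_monomial[OF that(2)], of _ 1] by (intro zero) simp
    moreover have "T M j s d = 0" if "j \<le> N" "s \<in> {a..b}" for j s
      using nonneg[OF trunc[OF that(2)] cone_limit_monomial[OF that(1)]] by (intro zero) simp
    moreover have "T i N b t = 0" if "i \<le> M" "t \<in> {c..d}" for i t
      using nonneg[OF cone_limit_monomial[OF that(1)] trunc[OF that(2)]] by (intro zero) simp
    moreover have "0 \<le> T M N s t" if "s \<in> {a..b}" "t \<in> {c..d}" for s t
      using nonneg[OF trunc[OF that(1)] trunc[OF that(2)]] by simp
    ultimately show ?thesis by simp
  qed
  have inequality: "0 \<le> integral {a..b} (\<lambda>y. integral {c..d} (\<lambda>z. P (y, z) * f (y, z)))"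
    if T0: "(\<forall>i\<in>{0..M}. \<forall>j\<in>{0..N}. T i j b d = 0) \<and> (\<forall>j\<in>{0..N}. \<forall>s\<in>{a..b}. T M j s d = 0) \<and>
      (\<forall>i\<in>{0..M}. \<forall>t\<in>{c..d}. T i N b t = 0) \<and> (\<forall>s\<in>{a..b}. \<forall>t\<in>{c..d}. 0 \<le> T M N s t)"
      and f: "nabla_convex (M + 1) (N + 1) {a..b} {c..d} f" "has_continuous_pderivs (M + 1) (N + 1) {a..b} {c..d} f"
    for f
  proof -
    have f': "has_continuous_pderivs (Suc M) (Suc N) {a..b} {c..d} f" using f(2) by simp
    have "integral {a..b} (\<lambda>y. integral {c..d} (\<lambda>z. P (y, z) * f (y, z))) = (LINT x|lborel. Q x * f x)"
      by (rule \<Lambda>) (use continuous_on_mixed_pderiv[OF f', of 0 0] in \<open>simp add: mixed_pderiv_00\<close>)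
    also have "0 \<le> \<dots>"
    proof (rule integral_nonneg_of_conditions[OF Q out ab cd f'])
      fix y z assume "y \<in> {a..b}" "z \<in> {c..d}"
      then show "0 \<le> (-1) ^ (Suc M + Suc N) * mixed_pderiv {a..b} {c..d} (Suc M) (Suc N) f (y, z)"
        using f(1) by (intro nabla_convex_imp_mixed_pderiv[OF f' _ ab cd]) simp_all
    qed (use T0 in \<open>auto simp: T_def\<close>)
    finally show ?thesis .
  qed
  show ?thesis
  \<comment> \<open>Rewriting with \<open>T\<close> requires the upper limits to lie in the
    intervals; \<open>ball_cong\<close> provides this for the quantified ones, \<open>b\<close> and
    \<open>d\<close> for the endpoints.\<close>
  proof (simp only: T b d cong: ball_cong, rule iffI, goal_cases)
    case 1
    then show ?case by (intro conditions) blast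
  next
    case 2
    then show ?case by (intro allI impI inequality)
  qed
qed

end
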